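(* Let $G$ be an infinite, connected, 1-ended graph of bounded degree with a fixed vertex $o$, and let $\mathcal{P}$ be a basis of the cycle space of $G$ consisting of cycles of uniformly bounded length. Let $\omega\in\{0,1\}^{E(G)}$ be a percolation instance. For every finite percolation cluster $C$ of $\omega$ such that $\partial C$ separates $o$ from infinity, there is a unique $\mathcal{P}$-interface $(I_V,I_O)$ that meets $C$ and occurs in $\omega$. Moreover, we have $I_O\subseteq E(C)$ and $I_V\subseteq\partial C$ for that $\mathcal{P}$-interface. Conversely, every $\mathcal{P}$-interface occurring in $\omega$ meets a unique percolation cluster $C$ of $\omega$, and $\partial C$ separates $o$ from infinity (in particular, $C$ is finite).
   Context: Basis of cycle space: the edge space of $G$ is $\bigoplus_{e\in E(G)}\mathbb{Z}_2$, and the cycle space is its subspace spanned by the edge sets of cycles of $G$. A basis here means a set $\mathcal{P}$ of cycles whose edge sets span the cycle space (e.g. for a finitely presented Cayley graph, the set of all cycles induced by the relators of a finite presentation). Percolation: an edge $e$ is occupied in $\omega$ if $\omega(e)=1$ and vacant if $\omega(e)=0$. The clusters of $\omega$ are the connected components of the subgraph with vertex set $V(G)$ and edge set the occupied edges. For a subgraph $S$, $\partial S$ is the set of edges of $G$ not in $E(S)$ with at least one endvertex in $S$. A set $F$ of edges separates $o$ from infinity if the component of $o$ in $G-F$ (deleting the edges $F$) is finite. Directed edges: each edge $vw$ has two directions $\vec{vw}$ (with head $w$) and $\vec{wv}$ (with head $v$). For $F\subset E(G)$ and a subgraph $D$ of $G$, let $\vec{F^D}:=\{\vec{vz} : vz\in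 F,\ z\in V(D)\}$. $\mathcal{P}$-paths: a $\mathcal{P}$-path connecting two directed edges $\vec{vw}$ and $\vec{xy}$ is a path $P$ of $G$ with endvertices $w,y$ (the heads; $P$ may consist of a single vertex $w=y$) such that the edge $vw$, the path $P$, and the edge $yx$ occur consecutively along some cycle in $\mathcal{P}$ (where $v=x$, or even $vw$ and $xy$ being the two directions of one edge, is allowed, in which case they exhaust the cycle). $P$ connects an undirected edge $e$ to a set $J$ of directed edges if it connects one of the two directions of $e$ to some element of $J$. $F$-connectedness: for $F\subset E(G)$, a set $J$ of directed edges is $F$-connected if for every partition of $J$ into two non-empty sets $J_1,J_2$ there is a $\mathcal{P}$-path in $G-F$ connecting an element of $J_1$ to an element of $J_2$ (the connected directed edges themselves may belong to $F$). A $\mathcal{P}$-interface is a pair $I=(I_V,I_O)$ of sets of edges of $G$ such that: (1) $I_V$ separates $o$ from infinity; (2) there is a unique finite component $D$ of $G-I_V$ containing a vertex of each edge in $I_V$; (3) $\vec{I_V^D}$ is $I_V$-connected; (4) $I_O=\{e\in E(D) : \text{there is a } \mathcal{P}\text{-path in } G-I_V \text{ connecting } e \text{ to } \vec{I_V^D}\}$. $I$ occurs in $\omega$ if every edge in $I_O$ is occupied and every edge in $I_V$ is vacant in $\omega$. $I$ meets a cluster $C$ of $\omega$ if either $I_O\cap E(C)\ne\emptyset$, or $I_O=E(C)=\emptyset$ and $I_V=\partial C$ (in which case $C$ consists of $o$ only).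
   Formalization: Added hypothesis: G−o is connected and no vertex other than o separates o from infinity. Without it the claim fails, e.g. for the square grid with a pendant edge at o, all edges vacant, C={o}. *)

theory Defs
  imports Main "HOL-Library.FuncSet" "HOL-Library.Z2" "HOL-Library.Function_Algebras"
    "HOL-Library.Indicator_Function"
begin

section \<open>Graphs\<close>

text \<open>Graphs are simple and undirected, possibly infinite. Components, clusters and cycles are
  all subgraphs, hence again values of this type.\<close>

record 'a graph =
  verts :: "'a set"
  edges :: "'a set set"

definition simple_graph :: "'a graph \<Rightarrow> bool" where
  "simple_graph G \<longleftrightarrow>
     (\<forall>e\<in>edges G. \<exists>u v. u \<in> verts G \<and> v \<in> verts G \<and> u \<noteq> v \<and> e = {u, v})"

definition bounded_degree :: "'a graph \<Rightarrow> bool" where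
  "bounded_degree G \<longleftrightarrow>
     (\<exists>d. \<forall>v\<in>verts G. finite {e \<in> edges G. v \<in> e} \<and> card {e \<in> edges G. v \<in> e} \<le> d)"

definition del_edges :: "'a graph \<Rightarrow> 'a set set \<Rightarrow> 'a graph" where
  "del_edges G F = \<lparr>verts = verts G, edges = edges G - F\<rparr>"

definition del_verts :: "'a graph \<Rightarrow> 'a set \<Rightarrow> 'a graph" where
  "del_verts G S = \<lparr>verts = verts G - S, edges = {e \<in> edges G. e \<inter> S = {}}\<rparr>"

definition subgraph :: "'a graph \<Rightarrow> 'a graph \<Rightarrow> bool" where
  "subgraph H G \<longleftrightarrow> verts H \<subseteq> verts G \<and> edges H \<subseteq> edges G"

definition graph_path :: "'a graph \<Rightarrow> 'a list \<Rightarrow> bool" where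
  "graph_path G p \<longleftrightarrow> p \<noteq> [] \<and> distinct p \<and> set p \<subseteq> verts G \<and>
     successively (\<lambda>u v. {u, v} \<in> edges G) p"

definition joined :: "'a graph \<Rightarrow> 'a \<Rightarrow> 'a \<Rightarrow> bool" where
  "joined G u v \<longleftrightarrow> (\<exists>p. graph_path G p \<and> hd p = u \<and> last p = v)"

definition connected_graph :: "'a graph \<Rightarrow> bool" where
  "connected_graph G \<longleftrightarrow> verts G \<noteq> {} \<and> (\<forall>u\<in>verts G. \<forall>v\<in>verts G. joined G u v)"

definition component :: "'a graph \<Rightarrow> 'a \<Rightarrow> 'a graph" where
  "component G v =
     \<lparr>verts = {u. joined G v u}, edges = {e \<in> edges G. e \<subseteq> {u. joined G v u}}\<rparr>"

definition graph_components :: "'a graph \<Rightarrow> 'a graph set" where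
  "graph_components G = component G ` verts G"

text \<open>Ends are equivalence classes of rays; two rays are equivalent if no finite set of vertices
  separates them.\<close>

definition ray :: "'a graph \<Rightarrow> (nat \<Rightarrow> 'a) \<Rightarrow> bool" where
  "ray G r \<longleftrightarrow> inj r \<and> range r \<subseteq> verts G \<and> (\<forall>n. {r n, r (Suc n)} \<in> edges G)"

definition ray_equiv :: "'a graph \<Rightarrow> (nat \<Rightarrow> 'a) \<Rightarrow> (nat \<Rightarrow> 'a) \<Rightarrow> bool" where
  "ray_equiv G r s \<longleftrightarrow>
     (\<forall>S. finite S \<and> S \<subseteq> verts G \<longrightarrow>
        (\<exists>K\<in>graph_components (del_verts G S). \<exists>n. \<forall>m\<ge>n. r m \<in> verts K \<and> s m \<in> verts K))"

definition ends :: "'a graph \<Rightarrow> (nat \<Rightarrow> 'a) set set" where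
  "ends G = {r. ray G r} // {(r, s). ray G r \<and> ray G s \<and> ray_equiv G r s}"

definition one_ended :: "'a graph \<Rightarrow> bool" where
  "one_ended G \<longleftrightarrow> card (ends G) = 1"

definition edge_boundary :: "'a graph \<Rightarrow> 'a graph \<Rightarrow> 'a set set" where
  "edge_boundary G S = {e \<in> edges G. e \<notin> edges S \<and> e \<inter> verts S \<noteq> {}}"

definition separates_from_infinity :: "'a graph \<Rightarrow> 'a set set \<Rightarrow> 'a \<Rightarrow> bool" where
  "separates_from_infinity G F v \<longleftrightarrow> finite (verts (component (del_edges G F) v))"


section \<open>Cycles and the cycle space\<close>

text \<open>\<open>traverses vs C\<close>: the list \<open>vs\<close> runs once around the cycle \<open>C\<close>, from some starting vertex
  and in one of the two orientations. All starting vertices and orientations are possible.\<close>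

definition traverses :: "'a list \<Rightarrow> 'a graph \<Rightarrow> bool" where
  "traverses vs C \<longleftrightarrow> 3 \<le> length vs \<and> distinct vs \<and> verts C = set vs \<and>
     edges C = {{vs ! i, vs ! (Suc i mod length vs)} | i. i < length vs}"

definition cycle_of :: "'a graph \<Rightarrow> 'a graph \<Rightarrow> bool" where
  "cycle_of G C \<longleftrightarrow> subgraph C G \<and> (\<exists>vs. traverses vs C)"

text \<open>The edge space consists of the finitely supported maps from the edges to the field with two
  elements; spans are taken among all maps, but spans of edge sets of cycles consist of finitely
  supported ones.\<close>

interpretation edge_space: vector_space "\<lambda>(c::bit) (f::'a set \<Rightarrow> bit) e. c * f e"
  by standard (simp_all only: fun_eq_iff plus_fun_apply distrib_left distrib_right mult.assoc mult_1_left simp_thms)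

definition cycle_space :: "'a graph \<Rightarrow> ('a set \<Rightarrow> bit) set" where
  "cycle_space G = edge_space.span {indicator (edges C) | C. cycle_of G C}"

text \<open>No linear independence is required.\<close>

definition cycle_basis :: "'a graph \<Rightarrow> 'a graph set \<Rightarrow> bool" where
  "cycle_basis G P \<longleftrightarrow> (\<forall>C\<in>P. cycle_of G C) \<and>
     edge_space.span ((\<lambda>C. indicator (edges C)) ` P) = cycle_space G"


section \<open>Percolation\<close>

definition occupied_graph :: "'a graph \<Rightarrow> ('a set \<Rightarrow> nat) \<Rightarrow> 'a graph" where
  "occupied_graph G \<omega> = \<lparr>verts = verts G, edges = {e \<in> edges G. \<omega> e = 1}\<rparr>"

definition clusters :: "'a graph \<Rightarrow> ('a set \<Rightarrow> nat) \<Rightarrow> 'a graph set" where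
  "clusters G \<omega> = graph_components (occupied_graph G \<omega>)"


section \<open>Interfaces\<close>

text \<open>The pair \<open>(v, w)\<close> is the direction of the edge \<open>{v, w}\<close> with head \<open>w\<close>.\<close>

definition arcs_into :: "'a set set \<Rightarrow> 'a graph \<Rightarrow> ('a \<times> 'a) set" where
  "arcs_into F D = {(v, z). {v, z} \<in> F \<and> z \<in> verts D}"

text \<open>\<open>P_path H P p (v, w) (x, y)\<close>: \<open>p\<close> is a path of \<open>H\<close> (in the applications \<open>H\<close> is obtained from
  the ambient graph by deleting edges) from \<open>w\<close> to \<open>y\<close> such that the edge \<open>vw\<close>, the path \<open>p\<close> and
  the edge \<open>yx\<close> are consecutive along a cycle in \<open>P\<close>. The traversal \<open>vs\<close> of that cycle is chosen
  to start at \<open>w\<close>, so \<open>p\<close> is its prefix of some length \<open>k\<close>, the vertex before \<open>p\<close> is the last one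
  of \<open>vs\<close>, and the vertex after \<open>p\<close> is the one at position \<open>k\<close>, cyclically. The case
  \<open>k = length vs - 1\<close> is \<open>v = x\<close>; in the case \<open>k = length vs\<close> the two directed edges are the two
  directions of one edge.\<close>

definition P_path ::
    "'a graph \<Rightarrow> 'a graph set \<Rightarrow> 'a list \<Rightarrow> 'a \<times> 'a \<Rightarrow> 'a \<times> 'a \<Rightarrow> bool" where
  "P_path H P p a b \<longleftrightarrow> graph_path H p \<and> hd p = snd a \<and> last p = snd b \<and>
     (\<exists>C\<in>P. \<exists>vs k. traverses vs C \<and> 1 \<le> k \<and> k \<le> length vs \<and> p = take k vs \<and>
        fst a = last vs \<and> fst b = vs ! (k mod length vs))"

definition P_path_edge_to ::
    "'a graph \<Rightarrow> 'a graph set \<Rightarrow> 'a list \<Rightarrow> 'a set \<Rightarrow> ('a \<times> 'a) set \<Rightarrow> bool" where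
  "P_path_edge_to H P p e J \<longleftrightarrow> (\<exists>v w. e = {v, w} \<and> (\<exists>b\<in>J. P_path H P p (v, w) b))"

definition F_connected ::
    "'a graph \<Rightarrow> 'a graph set \<Rightarrow> 'a set set \<Rightarrow> ('a \<times> 'a) set \<Rightarrow> bool" where
  "F_connected G P F J \<longleftrightarrow>
     (\<forall>J1 J2. J1 \<noteq> {} \<and> J2 \<noteq> {} \<and> J1 \<inter> J2 = {} \<and> J1 \<union> J2 = J \<longrightarrow>
        (\<exists>a\<in>J1. \<exists>b\<in>J2. \<exists>p. P_path (del_edges G F) P p a b))"

definition interface_component :: "'a graph \<Rightarrow> 'a set set \<Rightarrow> 'a graph \<Rightarrow> bool" where
  "interface_component G IV D \<longleftrightarrow>
     D \<in> graph_components (del_edges G IV) \<and> finite (verts D) \<and> (\<forall>e\<in>IV. e \<inter> verts D \<noteq> {})"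

fun interface :: "'a graph \<Rightarrow> 'a graph set \<Rightarrow> 'a \<Rightarrow> 'a set set \<times> 'a set set \<Rightarrow> bool" where
  "interface G P v\<^sub>0 (IV, IO) \<longleftrightarrow>
     IV \<subseteq> edges G \<and> IO \<subseteq> edges G \<and>
     separates_from_infinity G IV v\<^sub>0 \<and>
     (\<exists>!D. interface_component G IV D) \<and>
     (\<forall>D. interface_component G IV D \<longrightarrow>
        F_connected G P IV (arcs_into IV D) \<and>
        IO = {e \<in> edges D. \<exists>p. P_path_edge_to (del_edges G IV) P p e (arcs_into IV D)})"

fun occurs :: "('a set \<Rightarrow> nat) \<Rightarrow> 'a set set \<times> 'a set set \<Rightarrow> bool" where
  "occurs \<omega> (IV, IO) \<longleftrightarrow> (\<forall>e\<in>IO. \<omega> e = 1) \<and> (\<forall>e\<in>IV. \<omega> e = 0)"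

fun meets :: "'a graph \<Rightarrow> 'a set set \<times> 'a set set \<Rightarrow> 'a graph \<Rightarrow> bool" where
  "meets G (IV, IO) C \<longleftrightarrow>
     IO \<inter> edges C \<noteq> {} \<or> (IO = {} \<and> edges C = {} \<and> IV = edge_boundary G C)"


section \<open>Nondegeneracy of the root\<close>

text \<open>The root is not a cutvertex, and no other vertex separates it from infinity. This holds in
  particular in every 2-connected infinite graph. It excludes exactly the pairs of a graph and a
  root for which the correspondence between clusters and interfaces breaks down: see the lemma
  \<open>unpinched_necessary\<close> below. For example, let a pendant edge be attached to the root of the square
  grid and let all edges be vacant. The boundary of the cluster consisting of the root alone then
  contains the pendant edge, which lies on no cycle, so this boundary is not connected by P-paths
  and there is no interface that meets the cluster.\<close>

definition unpinched :: "'a graph \<Rightarrow> 'a \<Rightarrow> bool" where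
  "unpinched G v\<^sub>0 \<longleftrightarrow> connected_graph (del_verts G {v\<^sub>0}) \<and>
     (\<forall>x\<in>verts G - {v\<^sub>0}. infinite (verts (component (del_verts G {x}) v\<^sub>0)))"


lemma path_closed:
  assumes "successively (\<lambda>u v. {u, v} \<in> E) p" "p \<noteq> []" "hd p \<in> K"
    and "\<And>u v. {u, v} \<in> E \<Longrightarrow> u \<in> K \<Longrightarrow> v \<in> K"
  shows "set p \<subseteq> K"
  using assms(1-3)
proof (induction p)
  case (Cons a p)
  then show ?case
    using assms(4) by (cases p) auto
qed simp

lemma joined_closed:
  assumes "joined G u v" "u \<in> K" "\<And>a b. {a, b} \<in> edges G \<Longrightarrow> a \<in> K \<Longrightarrow> b \<in> K"
  shows "v \<in> K"
proof -
  obtain p where p: "graph_path G p" "hd p = u" "last p = v"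
    using assms(1) unfolding joined_def by blast
  then have ne: "p \<noteq> []" and s: "successively (\<lambda>a b. {a, b} \<in> edges G) p"
    unfolding graph_path_def by simp_all
  have "set p \<subseteq> K"
    by (rule path_closed[OF s ne]) (use p assms(2,3) in simp_all)
  then show ?thesis using last_in_set[OF ne] p(3) by blast
qed

lemma joined_refl: "v \<in> verts G \<Longrightarrow> joined G v v"
  unfolding joined_def graph_path_def by (intro exI[of _ "[v]"]) auto

lemma joined_step:
  assumes "joined G u v" "{v, w} \<in> edges G" "w \<in> verts G"
  shows "joined G u w"
proof -
  obtain p where p: "graph_path G p" "hd p = u" "last p = v"
    using assms(1) unfolding joined_def by blast
  show ?thesis
  proof (cases "w \<in> set p")
    case False
    then have "graph_path G (p @ [w])" "hd (p @ [w]) = u" "last (p @ [w]) = w"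
      using p assms unfolding graph_path_def by (auto simp: successively_append_iff)
    then show ?thesis unfolding joined_def by blast
  next
    case True
    then obtain ys zs where s: "p = (ys @ [w]) @ zs"
      by (metis append.assoc append_Cons append_Nil split_list)
    then have "successively (\<lambda>u v. {u, v} \<in> edges G) (ys @ [w])"
      using p(1) unfolding graph_path_def by (metis successively_append_iff)
    then have "graph_path G (ys @ [w])" "hd (ys @ [w]) = u" "last (ys @ [w]) = w"
      using p s unfolding graph_path_def by (auto simp: hd_append split: if_splits)
    then show ?thesis unfolding joined_def by blast
  qed
qed

lemma no_interface_at_cutvertex:
  assumes "simple_graph G" "x \<in> verts G" "cycle_basis G P"
    and K: "\<And>a b. {a, b} \<in> edges G \<Longrightarrow> a \<noteq> x \<Longrightarrow> b \<noteq> x \<Longrightarrow> a \<in> K \<Longrightarrow> b \<in> K"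
    and n1: "{n1, x} \<in> edges G" "n1 \<in> K"
    and n2: "{n2, x} \<in> edges G" "n2 \<notin> K"
  shows "\<not> interface G P v\<^sub>0 (edge_boundary G \<lparr>verts = {x}, edges = {}\<rparr>, IO)"
proof
  define IV where "IV = edge_boundary G \<lparr>verts = {x}, edges = {}\<rparr>"
  define D where "D = \<lparr>verts = {x}, edges = {} :: 'a set set\<rparr>"
  assume "interface G P v\<^sub>0 (edge_boundary G \<lparr>verts = {x}, edges = {}\<rparr>, IO)"
  then have I: "interface_component G IV D' \<Longrightarrow> F_connected G P IV (arcs_into IV D')" for D'
    unfolding IV_def by auto
  have IV: "IV = {e \<in> edges G. x \<in> e}" unfolding IV_def edge_boundary_def by auto
  have j: "joined (del_edges G IV) x u \<longleftrightarrow> u = x" for u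
  proof
    assume "joined (del_edges G IV) x u"
    then have "u \<in> {x}" by (rule joined_closed) (auto simp: IV del_edges_def)
    then show "u = x" by simp
  qed (use assms(2) in \<open>auto intro: joined_refl simp: del_edges_def\<close>)
  have "component (del_edges G IV) x = D"
    using assms(1) unfolding component_def D_def j
    by (auto simp: del_edges_def IV simple_graph_def)
  moreover have "x \<in> verts (del_edges G IV)" using assms(2) by (simp add: del_edges_def)
  ultimately have "D \<in> graph_components (del_edges G IV)"
    unfolding graph_components_def by blast
  then have "interface_component G IV D"
    unfolding interface_component_def by (auto simp: D_def IV)
  then have conn: "F_connected G P IV (arcs_into IV D)" by (rule I)
  define J1 where "J1 = {(v, z). {v, z} \<in> IV \<and> z = x \<and> v \<in> K}"
  define J2 where "J2 = {(v, z). {v, z} \<in> IV \<and> z = x \<and> v \<notin> K}"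
  have "(n1, x) \<in> J1" "(n2, x) \<in> J2"
    using n1 n2 unfolding J1_def J2_def by (simp_all add: IV)
  then have ne: "J1 \<noteq> {}" "J2 \<noteq> {}" by blast+
  have part: "J1 \<inter> J2 = {}" "J1 \<union> J2 = arcs_into IV D"
    unfolding J1_def J2_def arcs_into_def D_def by auto
  have "\<exists>a\<in>J1. \<exists>b\<in>J2. \<exists>p. P_path (del_edges G IV) P p a b"
    by (rule conn[unfolded F_connected_def, rule_format]) (intro conjI ne part)
  then obtain a b p where ab: "a \<in> J1" "b \<in> J2" "P_path (del_edges G IV) P p a b"
    by blast
  have "snd a = x" "snd b = x" using ab(1,2) unfolding J1_def J2_def by auto
  then have p: "graph_path (del_edges G IV) p" "hd p = x" "last p = x"
    using ab(3) unfolding P_path_def by simp_all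
  then obtain p' where "p = x # p'" by (cases p) (auto simp: graph_path_def)
  then have px: "p = [x]"
    using p unfolding graph_path_def by (cases "p' = []") auto
  obtain C vs k where C: "C \<in> P" "traverses vs C" "1 \<le> k" "k \<le> length vs" "p = take k vs"
      "fst a = last vs" "fst b = vs ! (k mod length vs)"
    using ab(3) unfolding P_path_def by blast
  then have k: "k = 1" using px by (metis length_take list.size(3,4) min.absorb2 One_nat_def add_0)
  obtain ws where vs: "vs = x # ws" using C(5) px k by (cases vs) auto
  have len: "length ws \<ge> 2" and dist: "x \<notin> set ws" "distinct ws"
    using C(2) vs unfolding traverses_def by auto
  have b: "fst b = hd ws" using C(7) vs k len by (cases ws) (auto simp: hd_conv_nth)
  have a: "fst a = last ws" using C(6) vs len by auto
  have sub: "edges C \<subseteq> edges G"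
    using assms(3) C(1) unfolding cycle_basis_def cycle_of_def subgraph_def by blast
  let ?E = "{e \<in> edges G. x \<notin> e}"
  have "successively (\<lambda>u v. {u, v} \<in> ?E) ws"
    unfolding successively_conv_nth
  proof (intro allI impI)
    fix i assume i: "Suc i < length ws"
    have "edges C = {{vs ! i, vs ! (Suc i mod length vs)} | i. i < length vs}"
      using C(2) unfolding traverses_def by blast
    moreover have "Suc i < length vs" using i vs by simp
    ultimately have "{vs ! Suc i, vs ! (Suc (Suc i) mod length vs)} \<in> edges C" by blast
    moreover have "Suc (Suc i) mod length vs = Suc (Suc i)" using i vs by simp
    ultimately have "{ws ! i, ws ! Suc i} \<in> edges G" using sub vs by auto
    moreover have "ws ! i \<noteq> x" "ws ! Suc i \<noteq> x"
      using dist(1) i by (metis nth_mem Suc_lessD, metis nth_mem)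
    ultimately show "{ws ! i, ws ! Suc i} \<in> ?E" by simp
  qed
  then have r: "successively (\<lambda>u v. {u, v} \<in> ?E) (rev ws)"
    unfolding successively_rev by (rule successively_mono) (auto simp: insert_commute)
  have ws: "ws \<noteq> []" using len by auto
  have "last ws \<in> K" using a ab(1) unfolding J1_def by auto
  then have hd: "hd (rev ws) \<in> K" using ws by (simp add: hd_rev)
  have "set (rev ws) \<subseteq> K"
  proof (rule path_closed[OF r _ hd])
    fix u v assume "{u, v} \<in> ?E" "u \<in> K"
    then show "v \<in> K" using K[of u v] by auto
  qed (use ws in simp)
  then have "hd ws \<in> K" using ws by (simp add: subset_iff)
  then show False using b ab(2) unfolding J2_def by auto
qed

text \<open>If already the first claim of the theorem holds for the percolation instance without occupied
  edges, then the root is nondegenerate.\<close>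

lemma unpinched_necessary:
  assumes G: "simple_graph G" "infinite (verts G)" "connected_graph G" "v\<^sub>0 \<in> verts G"
    and P: "cycle_basis G P"
    and claim: "\<And>C. C \<in> clusters G (\<lambda>_. 0) \<Longrightarrow> finite (verts C) \<Longrightarrow>
      separates_from_infinity G (edge_boundary G C) v\<^sub>0 \<Longrightarrow>
      \<exists>I. interface G P v\<^sub>0 I \<and> meets G I C"
  shows "unpinched G v\<^sub>0"
proof -
  have edge: "a \<in> verts G \<and> b \<in> verts G \<and> a \<noteq> b" if "{a, b} \<in> edges G" for a b
    using G(1) that unfolding simple_graph_def by (metis doubleton_eq_iff)
  have contra: False
    if x: "x \<in> verts G"
      and sep: "separates_from_infinity G (edge_boundary G \<lparr>verts = {x}, edges = {}\<rparr>) v\<^sub>0"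
      and u: "u \<in> verts G" "u \<noteq> x" and w: "w \<in> verts G" "w \<noteq> x"
      and nj: "\<not> joined (del_verts G {x}) u w"
    for x u w
  proof -
    let ?C = "\<lparr>verts = {x}, edges = {}\<rparr> :: 'a graph"
    define K where "K = {z. joined (del_verts G {x}) u z}"
    have uK: "u \<in> K" using u unfolding K_def by (auto intro: joined_refl simp: del_verts_def)
    have wK: "w \<notin> K" using nj unfolding K_def by simp
    have K: "b \<in> K" if "{a, b} \<in> edges G" "a \<noteq> x" "b \<noteq> x" "a \<in> K" for a b
      using that edge[of a b] joined_step[of "del_verts G {x}" u a b]
      unfolding K_def by (auto simp: del_verts_def)
    have xK: "x \<notin> K"
      unfolding K_def joined_def graph_path_def del_verts_def by (auto dest: last_in_set)
    have "\<exists>n. {n, x} \<in> edges G \<and> n \<in> K"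
    proof (rule ccontr)
      assume none: "\<nexists>n. {n, x} \<in> edges G \<and> n \<in> K"
      have "joined G u w" using G(3) u w unfolding connected_graph_def by blast
      then have "w \<in> K" using uK
        by (rule joined_closed) (metis K none xK)
      then show False using wK by simp
    qed
    then obtain n1 where n1: "{n1, x} \<in> edges G" "n1 \<in> K" by blast
    have "\<exists>n. {n, x} \<in> edges G \<and> n \<notin> K"
    proof (rule ccontr)
      assume none: "\<nexists>n. {n, x} \<in> edges G \<and> n \<notin> K"
      have "joined G w u" using G(3) u w unfolding connected_graph_def by blast
      then have "u \<in> - K - {x}"
      proof (rule joined_closed)
        fix a b assume ab: "{a, b} \<in> edges G" "a \<in> - K - {x}"
        have "b \<noteq> x" using ab none by blast
        moreover have "b \<notin> K" using ab K[of b a] \<open>b \<noteq> x\<close> by (auto simp: insert_commute)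
        ultimately show "b \<in> - K - {x}" by simp
      qed (use w wK in auto)
      then show False using uK by simp
    qed
    then obtain n2 where n2: "{n2, x} \<in> edges G" "n2 \<notin> K" by blast
    have j: "joined (occupied_graph G (\<lambda>_. 0)) x z \<longleftrightarrow> z = x" for z
    proof
      assume "joined (occupied_graph G (\<lambda>_. 0)) x z"
      then have "z \<in> {x}" by (rule joined_closed) (auto simp: occupied_graph_def)
      then show "z = x" by simp
    qed (use x in \<open>auto intro: joined_refl simp: occupied_graph_def\<close>)
    have "component (occupied_graph G (\<lambda>_. 0)) x = ?C"
      unfolding component_def j by (auto simp: occupied_graph_def)
    then have "?C \<in> clusters G (\<lambda>_. 0)"
      using x unfolding clusters_def graph_components_def by (force simp: occupied_graph_def)
    then obtain I where I: "interface G P v\<^sub>0 I" "meets G I ?C"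
      using claim[of ?C] sep by (metis finite.emptyI finite_insert graph.select_convs(1))
    obtain IV IO where IV: "I = (IV, IO)" by (cases I)
    have "IV = edge_boundary G ?C" using I(2) unfolding IV meets.simps by simp
    then have "interface G P v\<^sub>0 (edge_boundary G ?C, IO)" using I(1) by (simp only: IV)
    moreover have "\<not> interface G P v\<^sub>0 (edge_boundary G ?C, IO)"
      by (rule no_interface_at_cutvertex[OF G(1) x P _ n1 n2]) (rule K)
    ultimately show False by blast
  qed
  have sep: "separates_from_infinity G (edge_boundary G \<lparr>verts = {x}, edges = {}\<rparr>) v\<^sub>0"
    if "finite K" "v\<^sub>0 \<in> K" "\<And>a b. {a, b} \<in> edges G \<Longrightarrow> a \<noteq> x \<Longrightarrow> b \<noteq> x \<Longrightarrow> a \<in> K \<Longrightarrow> b \<in> K" for x K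
  proof -
    have "verts (component (del_edges G (edge_boundary G \<lparr>verts = {x}, edges = {}\<rparr>)) v\<^sub>0) \<subseteq> K"
    proof
      fix z assume "z \<in> verts (component (del_edges G (edge_boundary G \<lparr>verts = {x}, edges = {}\<rparr>)) v\<^sub>0)"
      then have "joined (del_edges G (edge_boundary G \<lparr>verts = {x}, edges = {}\<rparr>)) v\<^sub>0 z"
        by (simp add: component_def)
      then show "z \<in> K" using that(2)
        by (rule joined_closed) (use that(3) in \<open>auto simp: del_edges_def edge_boundary_def\<close>)
    qed
    then show ?thesis
      unfolding separates_from_infinity_def using that(1) finite_subset by blast
  qed
  show ?thesis
    unfolding unpinched_def
  proof (intro conjI ballI notI)
    have ne: "verts G - {v\<^sub>0} \<noteq> {}" using G(2) by (metis finite.emptyI finite_insert infinite_remove)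
    have "joined (del_verts G {v\<^sub>0}) u w" if "u \<in> verts G - {v\<^sub>0}" "w \<in> verts G - {v\<^sub>0}" for u w
      using contra[OF G(4) sep[of "{v\<^sub>0}"], of u w] that by blast
    then show "connected_graph (del_verts G {v\<^sub>0})"
      using ne unfolding connected_graph_def by (auto simp: del_verts_def)
  next
    fix x assume x: "x \<in> verts G - {v\<^sub>0}"
      and fin: "finite (verts (component (del_verts G {x}) v\<^sub>0))"
    define K where "K = {z. joined (del_verts G {x}) v\<^sub>0 z}"
    have "finite K" using fin unfolding K_def component_def by simp
    have "infinite (verts G - {x})" using G(2) by simp
    then obtain w where w: "w \<in> verts G - {x}" "w \<notin> K"
      using \<open>finite K\<close> by (meson finite_subset subsetI)
    have "v\<^sub>0 \<in> K" using x G(4) unfolding K_def by (auto intro: joined_refl simp: del_verts_def)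
    moreover have "b \<in> K" if "{a, b} \<in> edges G" "a \<noteq> x" "b \<noteq> x" "a \<in> K" for a b
      using that edge[of a b] joined_step[of "del_verts G {x}" "v\<^sub>0" a b]
      unfolding K_def by (auto simp: del_verts_def)
    ultimately have "separates_from_infinity G (edge_boundary G \<lparr>verts = {x}, edges = {}\<rparr>) v\<^sub>0"
      using sep \<open>finite K\<close> by blast
    then show False using contra[of x v\<^sub>0 w] x w G(4) unfolding K_def by auto
  qed
qed

end

theory Submission
  imports Defs
begin

text \<open>Let \<open>C\<close> be a finite connected subgraph. Call two boundary arcs with head in \<open>C\<close> equivalent if
  a chain of P-paths inside \<open>C\<close> leads from one to the other. If \<open>J\<close> is a union of equivalence
  classes, then every cycle of the basis contains an even number of edges with exactly one direction
  in \<open>J\<close>: its segments inside \<open>C\<close> match up the arcs in \<open>J\<close>. Evenness is linear, so it holds for all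
  cycles. Hence an arc in \<open>J\<close> whose ends can be joined avoiding the edges of \<open>J\<close> has its reverse in
  \<open>J\<close> as well, since the path closes up to a cycle with one such edge. It follows that all arcs
  coming from the infinite component \<open>X\<close> of the complement of \<open>C\<close> are equivalent, and that the edges
  of their class are the vacant part of an interface. Conversely, the vacant part of any interface
  that meets \<open>C\<close> and occurs is such a class, and it contains an arc from \<open>X\<close> because the component
  in its definition is finite.\<close>

section \<open>Graphs\<close>

text \<open>An interface is defined through \<open>G - IV\<close>, and the finite component
  \<open>D\<close> there may be larger than \<open>C\<close>: boundary edges outside
  \<open>IV\<close> attach further pieces of the complement. P-paths of \<open>G - IV\<close> are
  thus not a priori paths of \<open>C\<close>. Two facts bridge this gap. A P-path that starts in
  \<open>D\<close> and leads to an arc of \<open>IV\<close> into \<open>D\<close> runs along edges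
  of \<open>IO\<close>, since each of its edges starts a shorter P-path to the same arc. And for the
  interface built from \<open>C\<close>, no edge outside \<open>C\<close> qualifies for
  \<open>IO\<close>.

  A boundary edge with both ends in \<open>C\<close> gives two arcs and ends two segments of a
  cycle. It contributes 0 or 2 to the number of segment ends in \<open>J\<close> if both or none of
  its directions are in \<open>J\<close>; hence the count of edges with exactly one direction in
  \<open>J\<close>.

  One-endedness makes the complement of \<open>X\<close> finite, so that avoiding \<open>X\<close>
  amounts to being finite. Nondegeneracy of the root enters only for empty \<open>IO\<close>, where
  the interface meets a cluster through its boundary alone and that boundary has to identify the
  root.\<close>

lemma simple_graph_edgeD:
  assumes "simple_graph G" "{u, v} \<in> edges G"
  shows "u \<in> verts G" "v \<in> verts G" "u \<noteq> v"
  using assms unfolding simple_graph_def by (metis doubleton_eq_iff)+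

lemma edge_otherE:
  assumes "simple_graph G" "e \<in> edges G" "v \<in> e"
  obtains x where "e = {v, x}" "x \<in> verts G" "x \<noteq> v"
proof -
  obtain a b where ab: "a \<in> verts G" "b \<in> verts G" "a \<noteq> b" "e = {a, b}"
    using assms(1,2) unfolding simple_graph_def by auto
  show thesis
  proof (cases "v = a")
    case True
    with ab that[of b] show thesis by simp
  next
    case False
    with ab assms(3) have "v = b" by simp
    with ab that[of a] show thesis by (simp add: insert_commute)
  qed
qed

lemma simple_graph_subset:
  assumes "simple_graph G" "edges H \<subseteq> edges G" "verts H = verts G"
  shows "simple_graph H"
  using assms unfolding simple_graph_def by auto

lemma simple_graph_del_edges: "simple_graph G \<Longrightarrow> simple_graph (del_edges G F)"
  by (erule simple_graph_subset) (auto simp: del_edges_def)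

lemma simple_graph_occupied: "simple_graph G \<Longrightarrow> simple_graph (occupied_graph G \<omega>)"
  by (erule simple_graph_subset) (auto simp: occupied_graph_def)

lemma simple_graph_del_verts: "simple_graph G \<Longrightarrow> simple_graph (del_verts G S)"
  unfolding simple_graph_def del_verts_def by fastforce

lemma graph_path_mono:
  assumes "graph_path G p" "verts G \<subseteq> verts H" "edges G \<subseteq> edges H"
  shows "graph_path H p"
  using assms unfolding graph_path_def by (auto elim!: successively_mono)

lemma graph_path_rev: "graph_path G p \<Longrightarrow> graph_path G (rev p)"
  unfolding graph_path_def by (simp add: insert_commute)

lemma graph_path_step:
  assumes "graph_path G (x # y # p)"
  shows "{x, y} \<in> edges G" "graph_path G (y # p)"
  using assms unfolding graph_path_def by auto

lemma joined_verts:
  assumes "joined G u v"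
  shows "u \<in> verts G" "v \<in> verts G"
  using assms unfolding joined_def graph_path_def by (metis hd_in_set subsetD, metis last_in_set subsetD)

lemma joined_sym: "joined G u v \<Longrightarrow> joined G v u"
  unfolding joined_def by (metis graph_path_rev graph_path_def hd_rev last_rev)

lemma joined_mono:
  assumes "joined G u v" "verts G \<subseteq> verts H" "edges G \<subseteq> edges H"
  shows "joined H u v"
  using assms graph_path_mono unfolding joined_def by blast

lemma joined_edge_step:
  assumes "simple_graph G" "joined G u v" "{v, w} \<in> edges G"
  shows "joined G u w"
  using joined_step[OF assms(2,3)] simple_graph_edgeD(2)[OF assms(1,3)] by simp

lemma joined_trans:
  assumes "simple_graph G" "joined G u v" "joined G v w"
  shows "joined G u w"
proof -
  have "w \<in> {x. joined G u x}"
    using assms(3)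
  proof (rule joined_closed)
    fix a b assume "{a, b} \<in> edges G" "a \<in> {x. joined G u x}"
    then show "b \<in> {x. joined G u x}"
      using joined_edge_step[OF assms(1)] by simp
  qed (use assms(2) in simp)
  then show ?thesis by simp
qed

lemma joined_edge:
  assumes "simple_graph G" "{u, v} \<in> edges G"
  shows "joined G u v"
  using simple_graph_edgeD(1)[OF assms] joined_edge_step[OF assms(1) joined_refl assms(2)] by simp

lemma verts_component [simp]: "verts (component G v) = {u. joined G v u}"
  by (simp add: component_def)

lemma edges_component [simp]: "edges (component G v) = {e \<in> edges G. e \<subseteq> {u. joined G v u}}"
  by (simp add: component_def)

lemma component_eqI:
  assumes "simple_graph G" "joined G u v"
  shows "component G u = component G v"
proof -
  have "joined G u x \<longleftrightarrow> joined G v x" for x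
    using assms joined_trans joined_sym by metis
  then have "joined G u = joined G v" by blast
  then show ?thesis unfolding component_def by simp
qed

lemma graph_component_eq:
  assumes "simple_graph G" "K \<in> graph_components G" "x \<in> verts K"
  shows "K = component G x"
proof -
  obtain v where "K = component G v" using assms(2) unfolding graph_components_def by blast
  then show ?thesis using component_eqI[OF assms(1), of v x] assms(3) by simp
qed

lemma component_in_graph_components: "v \<in> verts G \<Longrightarrow> component G v \<in> graph_components G"
  unfolding graph_components_def by blast

lemma component_edge:
  assumes "simple_graph G" "{u, v} \<in> edges G" "u \<in> verts (component G x)"
  shows "{u, v} \<in> edges (component G x)"
  using assms(2,3) joined_edge_step[OF assms(1) _ assms(2), of x] by simp

lemma simple_graph_component: "simple_graph G \<Longrightarrow> simple_graph (component G v)"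
  unfolding simple_graph_def by fastforce

lemma joined_component:
  assumes "simple_graph G" "joined G u v"
  shows "joined (component G u) u v"
proof -
  let ?K = "{x. joined G u x \<and> joined (component G u) u x}"
  have "u \<in> ?K" using assms joined_verts by (auto intro!: joined_refl)
  with assms(2) have "v \<in> ?K"
  proof (rule joined_closed)
    fix a b assume ab: "{a, b} \<in> edges G" "a \<in> ?K"
    then have "{a, b} \<in> edges (component G u)" using component_edge[OF assms(1)] by auto
    then show "b \<in> ?K"
      using ab joined_edge_step[OF assms(1), of u a b]
        joined_edge_step[OF simple_graph_component[OF assms(1)], of u u a b] by simp
  qed
  then show ?thesis by simp
qed

lemma connected_component:
  assumes "simple_graph G" "v \<in> verts G"
  shows "connected_graph (component G v)"
  unfolding connected_graph_def
proof (intro conjI ballI)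
  fix x y assume "x \<in> verts (component G v)" "y \<in> verts (component G v)"
  then show "joined (component G v) x y"
    using assms joined_component joined_sym joined_trans[OF simple_graph_component[OF assms(1)]]
    by (metis mem_Collect_eq verts_component)
qed (use assms in \<open>auto intro: joined_refl\<close>)

lemma finite_edge_boundary:
  assumes "bounded_degree G" "finite (verts C)" "verts C \<subseteq> verts G"
  shows "finite (edge_boundary G C)"
proof (rule finite_subset)
  show "edge_boundary G C \<subseteq> (\<Union>v\<in>verts C. {e \<in> edges G. v \<in> e})"
    unfolding edge_boundary_def by auto
  show "finite (\<Union>v\<in>verts C. {e \<in> edges G. v \<in> e})"
    using assms unfolding bounded_degree_def by blast
qed

lemma finite_neighbours:
  assumes "bounded_degree G" "v \<in> verts G"
  shows "finite {w. {v, w} \<in> edges G}"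
proof (rule finite_subset)
  show "{w. {v, w} \<in> edges G} \<subseteq> \<Union>{e \<in> edges G. v \<in> e \<and> finite e}" by fastforce
  have "finite {e \<in> edges G. v \<in> e \<and> finite e}"
    using assms unfolding bounded_degree_def by (metis (mono_tags, lifting) Collect_mono finite_subset)
  then show "finite (\<Union>{e \<in> edges G. v \<in> e \<and> finite e})" by auto
qed

section \<open>Ends\<close>

text \<open>The step of Koenig's lemma: once \<open>v\<close> is deleted, its component is covered
  by \<open>v\<close> and the components at its finitely many neighbours outside \<open>A\<close>,
  so one of these is infinite.\<close>

lemma infinite_component_step:
  assumes G: "simple_graph G" "bounded_degree G"
    and v: "v \<in> verts G - A" "infinite {x. joined (del_verts G A) v x}"
  obtains w where "{v, w} \<in> edges G" "w \<in> verts G - insert v A"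
    "infinite {x. joined (del_verts G (insert v A)) w x}"
proof -
  let ?H = "del_verts G A" and ?H' = "del_verts G (insert v A)"
  let ?N = "{w. {v, w} \<in> edges G} - A"
  have s': "simple_graph ?H'" using G(1) by (rule simple_graph_del_verts)
  have N: "w \<in> verts ?H'" if "w \<in> ?N" for w
    using that simple_graph_edgeD[OF G(1), of v w] by (auto simp: del_verts_def)
  let ?K = "insert v (\<Union>w\<in>?N. {x. joined ?H' w x})"
  have "{x. joined ?H v x} \<subseteq> ?K"
  proof safe
    fix x assume x: "joined ?H v x" "x \<notin> (\<Union>w\<in>?N. {x. joined ?H' w x})"
    from x(1) have "x \<in> ?K"
    proof (rule joined_closed)
      fix a b assume ab: "{a, b} \<in> edges ?H" "a \<in> ?K"
      consider "b = v" | "a = v" | "a \<noteq> v" "b \<noteq> v" by blast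
      then show "b \<in> ?K"
      proof cases
        case 2
        then have "b \<in> ?N" using ab by (auto simp: del_verts_def)
        with joined_refl[OF N[OF this]] show ?thesis by blast
      next
        case 3
        then have e: "{a, b} \<in> edges ?H'" using ab by (auto simp: del_verts_def)
        obtain w where "w \<in> ?N" "joined ?H' w a" using ab(2) 3 by blast
        with joined_edge_step[OF s' this(2) e] show ?thesis by blast
      qed simp
    qed simp
    then show "x = v" using x(2) by blast
  qed
  then have "infinite ?K" using v(2) finite_subset by blast
  moreover have "finite ?N" using finite_neighbours[OF G(2)] v(1) by simp
  ultimately obtain w where "w \<in> ?N" "infinite {x. joined ?H' w x}" by auto
  then show thesis using that N by (auto simp: del_verts_def)
qed

lemma ray_exists:
  assumes G: "simple_graph G" "bounded_degree G"
    and v: "v \<in> verts G" "infinite {x. joined G v x}"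
  obtains r where "ray G r" "r 0 = v"
proof -
  \<comment> \<open>The first entry of a state collects the vertices already used; deleting them is
    what makes the ray injective.\<close>
  define ok where "ok = (\<lambda>(A, u). u \<in> verts G - A \<and> infinite {x. joined (del_verts G A) u x})"
  define step where "step = (\<lambda>(A :: 'a set, u) (A', u'). A' = insert u A \<and> {u, u'} \<in> edges G)"
  \<comment> \<open>The clause for \<open>n = 0\<close> pins the starting state within the dependent
    choice.\<close>
  have "\<exists>f. \<forall>n. (ok (f n) \<and> (n = 0 \<longrightarrow> f n = ({}, v))) \<and> step (f n) (f (Suc n))"
  proof (rule dependent_nat_choice)
    have "del_verts G {} = G" by (simp add: del_verts_def)
    then show "\<exists>s. ok s \<and> ((0::nat) = 0 \<longrightarrow> s = ({}, v))" using v by (simp add: ok_def)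
  next
    fix s and n :: nat assume s: "ok s \<and> (n = 0 \<longrightarrow> s = ({}, v))"
    obtain A u where Au: "s = (A, u)" by (cases s)
    have u: "u \<in> verts G - A" "infinite {x. joined (del_verts G A) u x}"
      using s by (auto simp: ok_def Au)
    obtain w where "{u, w} \<in> edges G" "w \<in> verts G - insert u A"
        "infinite {x. joined (del_verts G (insert u A)) w x}"
      by (rule infinite_component_step[OF G u])
    then show "\<exists>s'. (ok s' \<and> (Suc n = 0 \<longrightarrow> s' = ({}, v))) \<and> step s s'"
      by (intro exI[of _ "(insert u A, w)"]) (auto simp: ok_def step_def Au)
  qed
  then obtain f where ok: "\<And>n. ok (f n)" and f0: "f 0 = ({}, v)"
      and st: "\<And>n. step (f n) (f (Suc n))"
    by blast
  define r where "r n = snd (f n)" for n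
  have new: "r n \<in> verts G - fst (f n)" for n using ok[of n] by (auto simp: ok_def r_def split: prod.splits)
  have ed: "{r n, r (Suc n)} \<in> edges G" and suc: "fst (f (Suc n)) = insert (r n) (fst (f n))" for n
    using st[of n] by (auto simp: step_def r_def split: prod.splits)
  have in_fst: "r m \<in> fst (f n)" if "m < n" for m n
    using that by (induction n) (auto simp: suc less_Suc_eq)
  have "r m \<noteq> r n" if "m < n" for m n using in_fst[OF that] new[of n] by auto
  then have "inj r" by (metis injI linorder_neqE_nat)
  then have "ray G r" unfolding ray_def using new ed by auto
  then show thesis using that f0 by (simp add: r_def)
qed

lemma ray_joined:
  assumes "simple_graph G" "ray G r"
  shows "joined G (r m) (r (m + n))"
proof (induction n)
  case 0
  then show ?case using assms(2) by (auto simp: ray_def intro: joined_refl)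
next
  case (Suc n)
  moreover have "{r (m + n), r (m + Suc n)} \<in> edges G" using assms(2) unfolding ray_def by simp
  ultimately show ?case by (rule joined_edge_step[OF assms(1)])
qed

text \<open>A finite set contains only finitely many vertices of a ray, so some tail avoids it and
  stays in one component. Reflexivity places a ray in its own class, as
  \<open>one_ended_ray_equiv\<close> requires.\<close>

lemma ray_equiv_refl:
  assumes G: "simple_graph G" and r: "ray G r"
  shows "ray_equiv G r r"
  unfolding ray_equiv_def
proof (intro allI impI)
  fix S assume S: "finite S \<and> S \<subseteq> verts G"
  have "inj r" using r by (simp add: ray_def)
  then have "finite (r -` S)" using S by (intro finite_vimageI) auto
  then obtain n where n: "\<And>m. m \<in> r -` S \<Longrightarrow> m < n"
    unfolding finite_nat_set_iff_bounded by blast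
  define q where "q m = r (n + m)" for m
  have q: "q m \<notin> S" for m using n[of "n + m"] by (auto simp: q_def)
  have "ray (del_verts G S) q"
    unfolding ray_def
  proof (intro conjI allI)
    show "inj q"
    proof (rule injI)
      fix x y assume "q x = q y"
      then have "n + x = n + y" using \<open>inj r\<close> unfolding q_def by (rule injD[rotated])
      then show "x = y" by simp
    qed
    show "range q \<subseteq> verts (del_verts G S)" using r q by (auto simp: q_def ray_def del_verts_def)
    show "{q m, q (Suc m)} \<in> edges (del_verts G S)" for m
      using r q[of m] q[of "Suc m"] by (auto simp: q_def ray_def del_verts_def)
  qed
  then have j: "joined (del_verts G S) (q 0) (q m)" for m
    using ray_joined[OF simple_graph_del_verts[OF G], of S q 0] by simp
  have "r m \<in> verts (component (del_verts G S) (q 0))" if "m \<ge> n" for m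
    using j[of "m - n"] that by (simp add: q_def)
  moreover have "component (del_verts G S) (q 0) \<in> graph_components (del_verts G S)"
    using joined_verts[OF j[of 0]] by (simp add: component_in_graph_components)
  ultimately show "\<exists>K\<in>graph_components (del_verts G S). \<exists>n. \<forall>m\<ge>n. r m \<in> verts K \<and> r m \<in> verts K"
    by blast
qed

lemma one_ended_ray_equiv:
  assumes "simple_graph G" "one_ended G" "ray G r" "ray G s"
  shows "ray_equiv G r s"
proof -
  let ?R = "{(r, s). ray G r \<and> ray G s \<and> ray_equiv G r s}"
  have cls: "?R `` {x} \<in> ends G" if "ray G x" for x
    unfolding ends_def by (rule quotientI) (simp add: that)
  obtain E where "ends G = {E}" using assms(2) unfolding one_ended_def by (rule card_1_singletonE)
  then have "?R `` {r} = ?R `` {s}" using cls[OF assms(3)] cls[OF assms(4)] by simp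
  moreover have "s \<in> ?R `` {s}" using ray_equiv_refl[OF assms(1,4)] assms(4) by simp
  ultimately have "s \<in> ?R `` {r}" by (simp only:)
  then show ?thesis by simp
qed

lemma bounded_degree_del_verts: "bounded_degree G \<Longrightarrow> bounded_degree (del_verts G S)"
  unfolding bounded_degree_def
proof (elim exE)
  fix d assume d: "\<forall>v\<in>verts G. finite {e \<in> edges G. v \<in> e} \<and> card {e \<in> edges G. v \<in> e} \<le> d"
  show "\<exists>d. \<forall>v\<in>verts (del_verts G S). finite {e \<in> edges (del_verts G S). v \<in> e} \<and>
      card {e \<in> edges (del_verts G S). v \<in> e} \<le> d"
  proof (intro exI ballI)
    fix v assume "v \<in> verts (del_verts G S)"
    moreover have "{e \<in> edges (del_verts G S). v \<in> e} \<subseteq> {e \<in> edges G. v \<in> e}"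
      by (auto simp: del_verts_def)
    ultimately show "finite {e \<in> edges (del_verts G S). v \<in> e} \<and>
        card {e \<in> edges (del_verts G S). v \<in> e} \<le> d"
      using d by (auto simp: del_verts_def intro: finite_subset order_trans[OF card_mono])
  qed
qed

text \<open>Each infinite component of \<open>G - S\<close> contains a ray by Koenig's lemma. The
  two rays are equivalent in \<open>G\<close>, and \<open>S\<close> itself, inserted into the
  definition of equivalence, forces their tails into one component.\<close>

lemma one_ended_infinite_component_unique:
  assumes G: "simple_graph G" "bounded_degree G" "one_ended G"
    and S: "finite S" "S \<subseteq> verts G"
    and K: "K1 \<in> graph_components (del_verts G S)" "infinite (verts K1)"
      "K2 \<in> graph_components (del_verts G S)" "infinite (verts K2)"
  shows "K1 = K2"
proof -
  let ?H = "del_verts G S"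
  have H: "simple_graph ?H" "bounded_degree ?H"
    using G simple_graph_del_verts bounded_degree_del_verts by blast+
  have rr: "\<exists>r. ray G r \<and> (\<forall>n. K = component ?H (r n))"
    if K: "K \<in> graph_components ?H" "infinite (verts K)" for K
  proof -
    obtain v where v: "v \<in> verts ?H" "K = component ?H v"
      using K(1) unfolding graph_components_def by blast
    then have "infinite {x. joined ?H v x}" using K(2) by simp
    then obtain r where r: "ray ?H r" "r 0 = v" using ray_exists[OF H v(1)] by blast
    have "joined ?H v (r n)" for n using ray_joined[OF H(1) r(1), of 0 n] r(2) by simp
    then have "K = component ?H (r n)" for n using v(2) component_eqI[OF H(1)] by metis
    moreover have "ray G r" using r(1) unfolding ray_def del_verts_def by auto
    ultimately show ?thesis by blast
  qed
  obtain r where r: "ray G r" "\<And>n. K1 = component ?H (r n)" using rr[OF K(1,2)] by blast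
  obtain s where s: "ray G s" "\<And>n. K2 = component ?H (s n)" using rr[OF K(3,4)] by blast
  have "ray_equiv G r s" using one_ended_ray_equiv G r s by blast
  then obtain K n where "K \<in> graph_components ?H" "\<And>m. m \<ge> n \<Longrightarrow> r m \<in> verts K \<and> s m \<in> verts K"
    using S unfolding ray_equiv_def by blast
  then have "K = component ?H (r n)" "K = component ?H (s n)"
    using graph_component_eq[OF H(1)] by blast+
  then show ?thesis using r(2)[of n] s(2)[of n] by simp
qed

lemma edge_leaving:
  assumes "connected_graph G" "u \<in> verts G" "u \<in> K" "w \<in> verts G" "w \<notin> K"
  obtains a b where "{a, b} \<in> edges G" "a \<in> K" "b \<notin> K"
  using assms joined_closed[of G u w K] unfolding connected_graph_def by blast

lemma component_edge_leaving:
  assumes G: "simple_graph G" and x: "{x, z} \<in> edges G" "joined (del_verts G S) u x"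
    "\<not> joined (del_verts G S) u z"
  shows "z \<in> S"
proof (rule ccontr)
  assume "z \<notin> S"
  moreover have "x \<notin> S" using joined_verts(2)[OF x(2)] by (auto simp: del_verts_def)
  ultimately have "{x, z} \<in> edges (del_verts G S)" "z \<in> verts (del_verts G S)"
    using x(1) simple_graph_edgeD[OF G x(1)] by (auto simp: del_verts_def)
  then show False using x(2,3) joined_step by metis
qed

text \<open>Since \<open>G\<close> is connected and \<open>S\<close> nonempty, every component of
  \<open>G - S\<close> contains one of the finitely many neighbours of \<open>S\<close>. So there
  are finitely many components, one of them is infinite, and the others are finite by
  one-endedness.\<close>

lemma cofinite_component:
  assumes G: "simple_graph G" "infinite (verts G)" "connected_graph G" "bounded_degree G" "one_ended G"
    and S: "finite S" "S \<noteq> {}" "S \<subseteq> verts G"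
  obtains X where "X \<in> graph_components (del_verts G S)" "infinite (verts X)"
    "finite (verts G - verts X)"
proof -
  let ?H = "del_verts G S"
  have H: "simple_graph ?H" using G(1) by (rule simple_graph_del_verts)
  let ?N = "\<Union>s\<in>S. {w. {s, w} \<in> edges G}"
  have finN: "finite ?N" using S finite_neighbours[OF G(4)] by auto
  have "graph_components ?H \<subseteq> component ?H ` ?N"
  proof
    fix K assume K: "K \<in> graph_components ?H"
    then obtain v where v: "v \<in> verts ?H" "K = component ?H v"
      unfolding graph_components_def by blast
    obtain s where s: "s \<in> S" using S(2) by blast
    have "\<not> joined ?H v s" using s joined_verts[of ?H v s] by (auto simp: del_verts_def)
    moreover have "v \<in> verts G" "s \<in> verts G" using v(1) s S(3) by (auto simp: del_verts_def)
    ultimately obtain a b where "{a, b} \<in> edges G" "a \<in> {x. joined ?H v x}" "b \<notin> {x. joined ?H v x}"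
      by (rule_tac edge_leaving[OF G(3), of v "{x. joined ?H v x}" s]) (simp_all add: joined_refl[OF v(1)])
    then have ab: "{a, b} \<in> edges G" "joined ?H v a" "\<not> joined ?H v b" by simp_all
    then have "b \<in> S" using component_edge_leaving[OF G(1) ab] by simp
    then have "a \<in> ?N" using ab(1) by (auto simp: insert_commute)
    moreover have "K = component ?H a" using v(2) component_eqI[OF H ab(2)] by simp
    ultimately show "K \<in> component ?H ` ?N" by blast
  qed
  then have fin: "finite (graph_components ?H)" using finN finite_surj by blast
  have cover: "verts G \<subseteq> S \<union> (\<Union>K\<in>graph_components ?H. verts K)"
  proof
    fix x assume "x \<in> verts G"
    moreover have "x \<in> (\<Union>K\<in>graph_components ?H. verts K)" if "x \<in> verts ?H"
      using joined_refl[OF that] by (intro UN_I[OF component_in_graph_components[OF that]]) simp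
    ultimately show "x \<in> S \<union> (\<Union>K\<in>graph_components ?H. verts K)"
      by (auto simp: del_verts_def)
  qed
  have "\<exists>X\<in>graph_components ?H. infinite (verts X)"
  proof (rule ccontr)
    assume "\<not> ?thesis"
    then have "finite (S \<union> (\<Union>K\<in>graph_components ?H. verts K))" using fin S(1) by blast
    then show False using cover G(2) finite_subset by blast
  qed
  then obtain X where X: "X \<in> graph_components ?H" "infinite (verts X)" by blast
  have "finite (verts K)" if "K \<in> graph_components ?H - {X}" for K
    using one_ended_infinite_component_unique[OF G(1,4,5) S(1,3) X, of K] that by auto
  then have "finite (S \<union> (\<Union>K\<in>graph_components ?H - {X}. verts K))" using fin S(1) by blast
  moreover have "verts G - verts X \<subseteq> S \<union> (\<Union>K\<in>graph_components ?H - {X}. verts K)"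
    using cover by blast
  ultimately show thesis using that[OF X] finite_subset by metis
qed

section \<open>Traversals and P-paths\<close>

text \<open>Indexing modulo the length lets a segment of a cycle run past the end of the list
  without a case distinction.\<close>

definition cyc :: "'a list \<Rightarrow> nat \<Rightarrow> 'a" where
  "cyc vs i = vs ! (i mod length vs)"

lemma cyc_less [simp]: "i < length vs \<Longrightarrow> cyc vs i = vs ! i"
  by (simp add: cyc_def)

lemma cyc_add_length [simp]: "cyc vs (i + length vs) = cyc vs i"
  by (simp add: cyc_def)

lemma cyc_rotate: "vs \<noteq> [] \<Longrightarrow> cyc (rotate m vs) i = cyc vs (m + i)"
  by (simp add: cyc_def nth_rotate mod_add_right_eq)

lemma traverses_edges_image:
  assumes "traverses vs C"
  shows "edges C = (\<lambda>i. {cyc vs i, cyc vs (Suc i)}) ` {..<length vs}"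
  using assms unfolding traverses_def by (auto simp: cyc_def)

lemma edge_image_range:
  assumes "vs \<noteq> []"
  shows "(\<lambda>i. {cyc vs i, cyc vs (Suc i)}) ` {..<length vs} = range (\<lambda>i. {cyc vs i, cyc vs (Suc i)})"
proof -
  have "{cyc vs i, cyc vs (Suc i)} \<in> (\<lambda>i. {cyc vs i, cyc vs (Suc i)}) ` {..<length vs}" for i
    by (rule image_eqI[of _ _ "i mod length vs"]) (use assms in \<open>auto simp: cyc_def mod_Suc_eq\<close>)
  then show ?thesis by blast
qed

lemma traverses_iff:
  "traverses vs C \<longleftrightarrow> 3 \<le> length vs \<and> distinct vs \<and> verts C = set vs \<and>
     edges C = range (\<lambda>i. {cyc vs i, cyc vs (Suc i)})"
proof -
  have "{{vs ! i, vs ! (Suc i mod length vs)} | i. i < length vs}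
      = (\<lambda>i. {cyc vs i, cyc vs (Suc i)}) ` {..<length vs}"
    by (auto simp: cyc_def)
  then show ?thesis
    unfolding traverses_def using edge_image_range[of vs] by (cases "vs = []") auto
qed

lemma traverses_rotate:
  assumes "traverses vs C"
  shows "traverses (rotate m vs) C"
proof -
  have ne: "vs \<noteq> []" using assms by (auto simp: traverses_def)
  let ?e = "\<lambda>i. {cyc vs i, cyc vs (Suc i)}"
  have "range (\<lambda>i. ?e (m + i)) = range ?e"
  proof
    show "range ?e \<subseteq> range (\<lambda>i. ?e (m + i))"
    proof safe
      fix i
      \<comment> \<open>Adding \<open>m\<close> full turns to \<open>i\<close> leaves the edge
        unchanged and keeps the subtraction of \<open>m\<close> from truncating at zero.\<close>
      have "m \<le> i + m * length vs" using ne by (cases vs) auto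
      then have "m + (i + m * length vs - m) = i + m * length vs" by simp
      moreover have "cyc vs (j + m * length vs) = cyc vs j" for j by (simp add: cyc_def)
      ultimately have "?e i = ?e (m + (i + m * length vs - m))" by (metis add_Suc)
      then show "?e i \<in> range (\<lambda>i. ?e (m + i))" by blast
    qed
  qed blast
  then show ?thesis using assms ne by (simp add: traverses_iff cyc_rotate)
qed

lemma traverses_rev:
  assumes "traverses vs C"
  shows "traverses (rev vs) C"
proof -
  let ?n = "length vs"
  have n: "3 \<le> ?n" "vs \<noteq> []" using assms by (auto simp: traverses_def)
  let ?e = "\<lambda>vs i. {cyc vs i, cyc vs (Suc i)}"
  have sub: "range (?e (rev ws)) \<subseteq> range (?e ws)" if "length ws = ?n" for ws :: "'a list"
  proof -
    \<comment> \<open>Edge \<open>i\<close> of the reversed list is edge \<open>?n - 2 - i\<close>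
      of \<open>ws\<close>; the closing edge, at position \<open>?n - 1\<close>, corresponds to
      itself.\<close>
    have pt: "?e (rev ws) i \<in> range (?e ws)" if "i < ?n" for i
    proof (cases "Suc i = ?n")
      case True
      then have "?e (rev ws) i = ?e ws (?n - 1)"
        using n \<open>length ws = ?n\<close> by (auto simp: cyc_def rev_nth)
      then show ?thesis by blast
    next
      case False
      then have "?e (rev ws) i = ?e ws (?n - 2 - i)"
        using n that \<open>length ws = ?n\<close>
        by (auto simp: rev_nth Suc_diff_Suc numeral_2_eq_2)
      then show ?thesis by blast
    qed
    have "rev ws \<noteq> []" using that n by auto
    then have img: "range (?e (rev ws)) = ?e (rev ws) ` {..<?n}"
      using edge_image_range[of "rev ws"] that by simp
    show ?thesis unfolding img by (rule image_subsetI) (simp only: lessThan_iff pt)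
  qed
  have "range (?e (rev vs)) = range (?e vs)"
    using sub[of vs] sub[of "rev vs"] by auto
  then show ?thesis using assms by (simp add: traverses_iff)
qed

section \<open>Transfer, shortening, reversal and construction of P-paths\<close>

lemma P_path_cong:
  assumes "P_path H P p a b" "graph_path H' p"
  shows "P_path H' P p a b"
  using assms unfolding P_path_def by blast

lemma P_path_mono:
  assumes "P_path H P p a b" "verts H \<subseteq> verts H'" "edges H \<subseteq> edges H'"
  shows "P_path H' P p a b"
  using assms P_path_cong graph_path_mono P_path_def by metis

text \<open>Rotating the traversal by one makes \<open>w\<close> its last vertex, that is, the
  predecessor of the shortened path. This drives the induction that walks along a P-path towards its
  end arc \<open>b\<close>.\<close>

lemma P_path_step:
  assumes "P_path H P (w # w' # p) (v, w) b"
  shows "P_path H P (w' # p) (w, w') b"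
proof -
  obtain C vs k where C: "C \<in> P" "traverses vs C" "1 \<le> k" "k \<le> length vs" "w # w' # p = take k vs"
      "fst b = vs ! (k mod length vs)"
    using assms unfolding P_path_def by blast
  have k: "2 \<le> k" using C(4,5) by (metis One_nat_def Suc_le_mono length_Cons length_take min.absorb2
        le0 numeral_2_eq_2)
  obtain us where vs: "vs = w # us" using C(3,5) by (cases vs) (auto simp: take_Cons')
  have us: "w' # p = take (k - 1) us" using C(5) k vs by (cases k) auto
  have "traverses (us @ [w]) C" using traverses_rotate[OF C(2), of 1] vs by simp
  moreover have "w' # p = take (k - 1) (us @ [w])" using us C(4) vs by simp
  \<comment> \<open>For \<open>k = length vs\<close> the vertex after the path is \<open>w\<close>
    itself, which the rotation moves from position \<open>0\<close> to position
    \<open>k - 1\<close>.\<close>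
  moreover have "fst b = (us @ [w]) ! ((k - 1) mod length (us @ [w]))"
    using C(4,6) k vs by (cases "k = length vs") (auto simp: nth_append nth_Cons')
  ultimately have "\<exists>C\<in>P. \<exists>vs k. traverses vs C \<and> 1 \<le> k \<and> k \<le> length vs \<and> w' # p = take k vs \<and>
      w = last vs \<and> fst b = vs ! (k mod length vs)"
    using C(1,4) k vs
    by (intro bexI[of _ C] exI[of _ "us @ [w]"] exI[of _ "k - 1"]) auto
  moreover have "graph_path H (w' # p)" "last (w' # p) = snd b"
    using assms graph_path_step(2)[of H w w' p] unfolding P_path_def by auto
  ultimately show ?thesis unfolding P_path_def by simp
qed

lemma P_path_rev:
  assumes "P_path H P p a b"
  shows "P_path H P (rev p) b a"
proof -
  obtain C vs k where C: "C \<in> P" "traverses vs C" "1 \<le> k" "k \<le> length vs" "p = take k vs"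
      "fst a = last vs" "fst b = vs ! (k mod length vs)"
    using assms unfolding P_path_def by blast
  have ne: "vs \<noteq> []" using C(3,4) by auto
  \<comment> \<open>The new traversal has to start with the reversed path, so the two blocks are
    reversed separately; the result is a rotation of \<open>rev vs\<close>.\<close>
  define us where "us = rev (take k vs) @ rev (drop k vs)"
  have "us = rotate (length vs - k) (rev vs)"
  proof -
    have "rev vs = rev (drop k vs) @ rev (take k vs)" by (simp flip: rev_append)
    moreover have "length vs - k = length (rev (drop k vs))" by simp
    ultimately show ?thesis unfolding us_def using rotate_append by metis
  qed
  then have "traverses us C" using traverses_rotate traverses_rev C(2) by metis
  moreover have "k \<le> length us" "rev p = take k us" using C(4,5) by (simp_all add: us_def)
  moreover have "last us = fst b"
    using C(3,4,7) ne by (cases "k = length vs") (simp_all add: us_def last_rev hd_conv_nth hd_drop_conv_nth)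
  moreover have "us ! (k mod length us) = fst a"
  proof (cases "k = length vs")
    case True
    then show ?thesis using C(6) ne by (simp add: us_def hd_conv_nth[symmetric] hd_rev)
  next
    case False
    then have "us ! (k mod length us) = rev (drop k vs) ! 0"
      using C(4) by (simp add: us_def nth_append)
    also have "\<dots> = last vs" using False C(4) by (simp add: hd_conv_nth[symmetric] hd_rev)
    finally show ?thesis using C(6) by simp
  qed
  ultimately have "\<exists>C\<in>P. \<exists>vs k. traverses vs C \<and> 1 \<le> k \<and> k \<le> length vs \<and> rev p = take k vs \<and>
      fst b = last vs \<and> fst a = vs ! (k mod length vs)"
    using C(1,3) by metis
  then show ?thesis
    using assms graph_path_rev unfolding P_path_def graph_path_def
    by (auto simp: hd_rev last_rev insert_commute)
qed

text \<open>Turns a run of positions \<open>m\<close> to \<open>m + l\<close> on a cycle into a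
  P-path. The position before \<open>m\<close> is written \<open>m + length vs - 1\<close> because
  \<open>m\<close> may be \<open>0\<close>, and \<open>l < length vs\<close> keeps the vertices
  distinct.\<close>

lemma P_path_along_cycle:
  assumes Q: "Q \<in> P" "traverses vs Q" "set vs \<subseteq> verts H" and l: "l < length vs"
    and H: "\<And>j. j < l \<Longrightarrow> {cyc vs (m + j), cyc vs (Suc (m + j))} \<in> edges H"
  shows "\<exists>p. P_path H P p (cyc vs (m + length vs - 1), cyc vs m) (cyc vs (Suc (m + l)), cyc vs (m + l))"
proof
  let ?us = "rotate m vs" and ?p = "take (Suc l) (rotate m vs)"
  have ne: "vs \<noteq> []" "?us \<noteq> []" using l by auto
  have nth: "?us ! i = cyc vs (m + i)" if "i < length vs" for i
    using cyc_rotate[OF ne(1), of m i] that by simp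
  have "graph_path H ?p"
    unfolding graph_path_def
  proof (intro conjI)
    show "distinct ?p" using Q(2) by (simp add: traverses_def)
    show "set ?p \<subseteq> verts H" 
      using order_trans[OF set_take_subset[of "Suc l" ?us]] Q(3) by simp
    show "successively (\<lambda>u v. {u, v} \<in> edges H) ?p"
      unfolding successively_conv_nth using H l by (auto simp: nth)
  qed (use ne l in simp)
  moreover have "hd ?p = cyc vs m" "last ?p = cyc vs (m + l)"
    using ne l by (simp_all add: hd_conv_nth last_conv_nth nth)
  moreover have "cyc vs (m + length vs - 1) = last ?us"
    using ne l by (simp add: last_conv_nth nth)
  moreover have "cyc vs (Suc (m + l)) = ?us ! (Suc l mod length ?us)"
    using cyc_rotate[OF ne(1), of m "Suc l"] by (simp add: cyc_def)
  ultimately show "P_path H P ?p (cyc vs (m + length vs - 1), cyc vs m)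
      (cyc vs (Suc (m + l)), cyc vs (m + l))"
    unfolding P_path_def using Q(1) traverses_rotate[OF Q(2), of m] l
    by (intro conjI bexI[of _ Q] exI[of _ ?us] exI[of _ "Suc l"]) simp_all
qed

section \<open>Parity\<close>

text \<open>These are the unions of classes. Closure is demanded in one direction, and
  \<open>P_path_rev\<close> supplies the other. A path of \<open>G\<close> minus the boundary that
  starts in \<open>C\<close> cannot leave \<open>C\<close>, so these P-paths run inside
  \<open>C\<close>.\<close>

definition arc_closed :: "'a graph \<Rightarrow> 'a graph set \<Rightarrow> 'a graph \<Rightarrow> ('a \<times> 'a) set \<Rightarrow> bool" where
  "arc_closed G P C J \<longleftrightarrow> J \<subseteq> arcs_into (edge_boundary G C) C \<and>
     (\<forall>a\<in>J. \<forall>b\<in>arcs_into (edge_boundary G C) C. \<forall>p.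
        P_path (del_edges G (edge_boundary G C)) P p a b \<longrightarrow> b \<in> J)"

definition arc_edges :: "('a \<times> 'a) set \<Rightarrow> 'a set set" where
  "arc_edges J = {{u, v} | u v. (u, v) \<in> J}"

definition one_way :: "('a \<times> 'a) set \<Rightarrow> 'a set set" where
  "one_way J = {{u, v} | u v. (u, v) \<in> J \<and> (v, u) \<notin> J}"

lemma one_way_iff: "{u, v} \<in> one_way J \<longleftrightarrow> ((u, v) \<in> J) \<noteq> ((v, u) \<in> J)"
  unfolding one_way_def by (auto simp: doubleton_eq_iff)

lemma one_way_subset: "one_way J \<subseteq> arc_edges J"
  unfolding one_way_def arc_edges_def by blast

lemma arc_edges_boundary: "arc_closed G P C J \<Longrightarrow> arc_edges J \<subseteq> edge_boundary G C"
  unfolding arc_closed_def arc_edges_def arcs_into_def by blast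

lemma arc_closedD:
  assumes "arc_closed G P C J" "P_path (del_edges G (edge_boundary G C)) P p a b"
    "a \<in> arcs_into (edge_boundary G C) C" "b \<in> arcs_into (edge_boundary G C) C"
  shows "a \<in> J \<longleftrightarrow> b \<in> J"
  using assms P_path_rev[OF assms(2)] unfolding arc_closed_def by blast

text \<open>Walking around a cycle, every maximal segment inside \<open>C\<close> has both or none of its two end
  arcs in \<open>J\<close>. The colour of a position is the status of the segment through it, and False outside
  \<open>C\<close>.\<close>

lemma one_way_colouring:
  fixes vs :: "'a list"
  assumes C: "simple_graph C" "subgraph C G" and Q: "cycle_of G Q" "Q \<in> P" "traverses vs Q"
    and J: "arc_closed G P C J"
  shows "\<exists>t :: nat \<Rightarrow> bool. t (length vs) = t 0 \<and>
    (\<forall>i. {cyc vs i, cyc vs (Suc i)} \<in> one_way J \<longleftrightarrow> t i \<noteq> t (Suc i))"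
proof -
  let ?n = "length vs" and ?g = "cyc vs"
  let ?e = "\<lambda>i. {?g i, ?g (Suc i)}" and ?bd = "edge_boundary G C"
  let ?A = "arcs_into ?bd C"
  \<comment> \<open>The colour looks forward: from position \<open>i\<close> along edges of
    \<open>C\<close> to the arc that ends the segment. That the arc starting the segment has the
    same status is the content of \<open>seg\<close>.\<close>
  define t where "t i \<longleftrightarrow> ?g i \<in> verts C \<and>
    (\<exists>l. (\<forall>j<l. ?e (i + j) \<in> edges C) \<and> (?g (Suc (i + l)), ?g (i + l)) \<in> J)" for i
  have n: "?n \<ge> 3" "vs \<noteq> []" using Q(3) by (auto simp: traverses_def)
  have eG: "?e i \<in> edges G" for i
    using Q(1,3) by (auto simp: cycle_of_def subgraph_def traverses_iff)
  have vG: "set vs \<subseteq> verts G" using Q(1,3) by (auto simp: cycle_of_def subgraph_def traverses_iff)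
  have eC: "?g i \<in> verts C \<and> ?g (Suc i) \<in> verts C" if "?e i \<in> edges C" for i
    using simple_graph_edgeD[OF C(1) that] by simp
  have JA: "J \<subseteq> ?A" using J by (simp add: arc_closed_def)
  have notC: "{u, v} \<notin> edges C" "v \<in> verts C" if "(u, v) \<in> J" for u v
    using JA that by (auto simp: arcs_into_def edge_boundary_def)
  have Ef: "(?g i, ?g (Suc i)) \<in> ?A" if "?e i \<notin> edges C" "?g (Suc i) \<in> verts C" for i
    using that eG[of i] by (auto simp: arcs_into_def edge_boundary_def)
  have Eb: "(?g (Suc i), ?g i) \<in> ?A" if "?e i \<notin> edges C" "?g i \<in> verts C" for i
    using that eG[of i] by (auto simp: arcs_into_def edge_boundary_def insert_commute)
  have per: "?e (i + ?n) = ?e i" for i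
    using cyc_add_length[of vs i] cyc_add_length[of vs "Suc i"] by simp
  have seg: "(?g i, ?g (Suc i)) \<in> J \<longleftrightarrow> (?g (Suc (Suc i + l)), ?g (Suc i + l)) \<in> J"
    if l: "\<And>j. j < l \<Longrightarrow> ?e (Suc i + j) \<in> edges C" and i: "?e i \<notin> edges C" "?g (Suc i) \<in> verts C"
      and last: "?e (Suc i + l) \<notin> edges C" for i l
  proof -
    \<comment> \<open>A longer run would go all the way around the cycle and pass the edge at
      \<open>i\<close>, which is not in \<open>C\<close>.\<close>
    have "l < ?n"
    proof (rule ccontr)
      assume "\<not> l < ?n"
      then have "?e (Suc i + (?n - 1)) \<in> edges C" using l[of "?n - 1"] n by auto
      moreover have "Suc i + (?n - 1) = i + ?n" using n by simp
      ultimately show False using i(1) per[of i] by (simp only:)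
    qed
    moreover have "?e (Suc i + j) \<in> edges (del_edges G ?bd)" if "j < l" for j
      using l[OF that] eG by (simp add: del_edges_def edge_boundary_def)
    ultimately obtain p where p: "P_path (del_edges G ?bd) P p (?g (Suc i + ?n - 1), ?g (Suc i))
        (?g (Suc (Suc i + l)), ?g (Suc i + l))"
      using P_path_along_cycle[OF Q(2,3), of "del_edges G ?bd" l "Suc i"] vG
      by (auto simp: del_edges_def)
    moreover have "?g (Suc i + ?n - 1) = ?g i" by simp
    moreover have "?g (Suc i + l) \<in> verts C"
      using i(2) eC[OF l[of "l - 1"]] by (cases l) auto
    ultimately show ?thesis using arc_closedD[OF J] Ef[OF i] Eb[OF last] by metis
  qed
  have "?e i \<in> one_way J \<longleftrightarrow> t i \<noteq> t (Suc i)" for i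
  proof (cases "?e i \<in> edges C")
    case True
    have "t i = t (Suc i)"
    proof
      assume "t i"
      then obtain l where l: "\<And>j. j < l \<Longrightarrow> ?e (i + j) \<in> edges C"
          "(?g (Suc (i + l)), ?g (i + l)) \<in> J"
        unfolding t_def by blast
      have "l \<noteq> 0"
      proof
        assume "l = 0"
        then show False using notC(1)[OF l(2)] True by (simp add: insert_commute)
      qed
      then obtain l' where "l = Suc l'" by (cases l) auto
      then have "\<And>j. j < l' \<Longrightarrow> ?e (Suc i + j) \<in> edges C"
          "(?g (Suc (Suc i + l')), ?g (Suc i + l')) \<in> J"
        using l(1)[of "Suc _"] l(2) by auto
      then show "t (Suc i)" unfolding t_def using eC[OF True] by blast
    next
      assume "t (Suc i)"
      then obtain l where l: "\<And>j. j < l \<Longrightarrow> ?e (Suc i + j) \<in> edges C"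
          "(?g (Suc (Suc i + l)), ?g (Suc i + l)) \<in> J"
        unfolding t_def by blast
      have "?e (i + j) \<in> edges C" if "j < Suc l" for j
        using that l(1)[of "j - 1"] True by (cases j) auto
      moreover have "(?g (Suc (i + Suc l)), ?g (i + Suc l)) \<in> J" using l(2) by simp
      ultimately show "t i" unfolding t_def using eC[OF True] by blast
    qed
    moreover have "(?g i, ?g (Suc i)) \<notin> J" "(?g (Suc i), ?g i) \<notin> J"
      using notC(1)[of "?g i" "?g (Suc i)"] notC(1)[of "?g (Suc i)" "?g i"] True
      by (auto simp: insert_commute)
    ultimately show ?thesis by (simp add: one_way_iff)
  next
    case False
    have b: "t i \<longleftrightarrow> (?g (Suc i), ?g i) \<in> J"
    proof
      assume "t i"
      then obtain l where l: "\<And>j. j < l \<Longrightarrow> ?e (i + j) \<in> edges C"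
          "(?g (Suc (i + l)), ?g (i + l)) \<in> J"
        unfolding t_def by blast
      have "l = 0" using l(1)[of 0] False by auto
      then show "(?g (Suc i), ?g i) \<in> J" using l(2) by simp
    next
      assume "(?g (Suc i), ?g i) \<in> J"
      then show "t i" unfolding t_def using notC(2) by (intro conjI exI[of _ 0]) auto
    qed
    have f: "t (Suc i) \<longleftrightarrow> (?g i, ?g (Suc i)) \<in> J"
    proof
      assume "t (Suc i)"
      then obtain l where l: "\<And>j. j < l \<Longrightarrow> ?e (Suc i + j) \<in> edges C"
          "(?g (Suc (Suc i + l)), ?g (Suc i + l)) \<in> J" "?g (Suc i) \<in> verts C"
        unfolding t_def by blast
      have "?e (Suc i + l) \<notin> edges C" using notC(1)[OF l(2)] by (simp add: insert_commute)
      then show "(?g i, ?g (Suc i)) \<in> J" using seg[OF l(1) False l(3)] l(2) by blast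
    next
      assume *: "(?g i, ?g (Suc i)) \<in> J"
      \<comment> \<open>The run from \<open>Suc i\<close> ends somewhere, because the edge at
        \<open>i\<close> recurs after a full turn.\<close>
      define l where "l = (LEAST l. ?e (Suc i + l) \<notin> edges C)"
      have "Suc i + (?n - 1) = i + ?n" using n by simp
      then have "?e (Suc i + (?n - 1)) \<notin> edges C" using per[of i] False by (simp only: not_False_eq_True)
      then have l: "?e (Suc i + l) \<notin> edges C" unfolding l_def by (rule LeastI)
      have lt: "?e (Suc i + j) \<in> edges C" if "j < l" for j
        using not_less_Least[of j "\<lambda>l. ?e (Suc i + l) \<notin> edges C"] that unfolding l_def by blast
      have "(?g (Suc (Suc i + l)), ?g (Suc i + l)) \<in> J"
        using seg[OF lt False notC(2)[OF *] l] * by blast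
      then show "t (Suc i)" unfolding t_def using lt notC(2)[OF *] by blast
    qed
    show ?thesis using b f by (auto simp: one_way_iff)
  qed
  moreover have "t ?n = t 0"
  proof -
    have p: "?g (?n + j) = ?g j" for j using cyc_add_length[of vs j] by (simp only: add.commute)
    have "?g (Suc (?n + j)) = ?g (Suc j)" for j using p[of "Suc j"] by (simp only: add_Suc_right)
    moreover have "?g ?n = ?g 0" using p[of 0] by (simp only: add_0_right)
    ultimately show ?thesis unfolding t_def using p by (simp only: add_0)
  qed
  ultimately have "t ?n = t 0 \<and> (\<forall>i. ?e i \<in> one_way J \<longleftrightarrow> t i \<noteq> t (Suc i))" by (simp only: simp_thms)
  then show ?thesis by (rule exI[of _ t])
qed

lemma sum_indicator_of_nat:
  "finite A \<Longrightarrow> (\<Sum>x\<in>A. indicator B x) = (of_nat (card (A \<inter> B)) :: 'b::semiring_1)"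
  by (simp add: indicator_def sum_of_bool_eq)

text \<open>Along the traversal the edges of \<open>one_way J\<close> are exactly the changes of
  colour, and a closed walk changes colour an even number of times: over two elements the sum
  telescopes to a comparison of the first and the last colour.\<close>

lemma one_way_even:
  assumes C: "simple_graph C" "subgraph C G" and Q: "cycle_of G Q" "Q \<in> P"
    and J: "arc_closed G P C J" "finite (one_way J)"
  shows "(\<Sum>e\<in>one_way J. indicator (edges Q) e) = (0 :: bit)"
proof -
  obtain vs where vs: "traverses vs Q" using Q(1) unfolding cycle_of_def by blast
  have n: "length vs \<ge> 3" "distinct vs" using vs by (auto simp: traverses_def)
  let ?e = "\<lambda>i. {cyc vs i, cyc vs (Suc i)}"
  obtain t :: "nat \<Rightarrow> bool" where "t (length vs) = t 0 \<and> (\<forall>i. ?e i \<in> one_way J \<longleftrightarrow> t i \<noteq> t (Suc i))"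
    using one_way_colouring[OF C Q vs J(1)] by (rule exE)
  then have t: "t (length vs) = t 0" "?e i \<in> one_way J \<longleftrightarrow> t i \<noteq> t (Suc i)" for i
    by (rule conjunct1, elim conjE allE)
  have tele: "(\<Sum>i<m. of_bool (?e i \<in> one_way J)) = (of_bool (t 0 \<noteq> t m) :: bit)" for m
    by (induction m) (auto simp: t(2))
  \<comment> \<open>Distinct positions give distinct edges because the cycle has at least three
    vertices; with two vertices both positions would carry the same edge.\<close>
  have inj: "inj_on ?e {..<length vs}"
  proof (rule inj_onI)
    fix i j assume ij: "i \<in> {..<length vs}" "j \<in> {..<length vs}" "?e i = ?e j"
    have nth: "vs ! a = vs ! b \<longleftrightarrow> a = b" if "a < length vs" "b < length vs" for a b
      using nth_eq_iff_index_eq[OF n(2) that] .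
    have "0 < length vs" using n(1) by linarith
    then have S: "Suc i mod length vs < length vs" "Suc j mod length vs < length vs"
      by (rule mod_less_divisor)+
    show "i = j"
      using ij n(1) S unfolding cyc_def
      by (auto simp: doubleton_eq_iff nth mod_Suc split: if_splits)
  qed
  \<comment> \<open>Both sums are the size of \<open>edges Q \<inter> one_way J\<close> modulo
    2.\<close>
  have "(\<Sum>e\<in>one_way J. indicator (edges Q) e) = (\<Sum>e\<in>edges Q. indicator (one_way J) e :: bit)"
  proof -
    have "finite (edges Q)" by (simp add: traverses_edges_image[OF vs])
    then show ?thesis using J(2) by (simp add: sum_indicator_of_nat Int_commute)
  qed
  also have "\<dots> = (\<Sum>i<length vs. of_bool (?e i \<in> one_way J))"
    unfolding traverses_edges_image[OF vs] sum.reindex[OF inj] by (simp add: indicator_def)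
  also have "\<dots> = 0" unfolding tele t(1) by simp
  finally show ?thesis .
qed

text \<open>Summation over \<open>B\<close> is a linear functional, so it vanishes on a span once it
  vanishes on the generators. This is how the spanning property of \<open>P\<close> enters.\<close>

lemma cycle_space_orthogonal:
  fixes G :: "'a graph"
  assumes "cycle_basis G P" "f \<in> cycle_space G"
    and P: "\<And>Q. Q \<in> P \<Longrightarrow> (\<Sum>e\<in>B. indicator (edges Q) e) = (0 :: bit)"
  shows "(\<Sum>e\<in>B. f e) = 0"
proof -
  have "f \<in> edge_space.span ((\<lambda>C. indicator (edges C)) ` P)"
    using assms(1,2) by (simp add: cycle_basis_def)
  then show ?thesis
  proof (induction rule: edge_space.span_induct_alt)
    case (step c x y)
    from step(1) obtain Q where "Q \<in> P" "x = indicator (edges Q)" by blast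
    then have "c * (\<Sum>e\<in>B. x e) = 0" using P by simp
    then have "(\<Sum>e\<in>B. c * x e) = 0" unfolding sum_distrib_left .
    then show ?case using step(2) unfolding plus_fun_apply sum.distrib by simp
  qed simp
qed

lemma path_plus_edge_cycle:
  assumes G: "simple_graph G" "{u, v} \<in> edges G" and j: "joined (del_edges G F) u v" "{u, v} \<in> F"
  obtains Q where "cycle_of G Q" "edges Q \<inter> F = {{u, v}}"
proof -
  obtain p where p: "graph_path (del_edges G F) p" "hd p = u" "last p = v"
    using j(1) unfolding joined_def by blast
  let ?n = "length p"
  have ne: "p \<noteq> []" "distinct p" and suc: "\<And>i. Suc i < ?n \<Longrightarrow> {p ! i, p ! Suc i} \<in> edges G - F"
    using p(1) by (auto simp: graph_path_def del_edges_def successively_conv_nth)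
  have hl: "p ! 0 = u" "p ! (?n - 1) = v" using p ne by (simp_all add: hd_conv_nth last_conv_nth)
  \<comment> \<open>A one-vertex path would make \<open>{u, v}\<close> a loop, and a two-vertex path
    would be the edge \<open>{u, v}\<close> itself, which lies in \<open>F\<close>. So there are
    enough vertices for a cycle.\<close>
  have "?n \<noteq> 1" using hl simple_graph_edgeD(3)[OF G] by auto
  moreover have "?n \<noteq> 2" using hl suc[of 0] j(2) by auto
  moreover have "?n \<noteq> 0" using ne by simp
  ultimately have n: "3 \<le> ?n" by linarith
  define Q where "Q = \<lparr>verts = set p, edges = {{p ! i, p ! (Suc i mod ?n)} | i. i < ?n}\<rparr>"
  have tr: "traverses p Q" using n ne by (simp add: traverses_def Q_def)
  have e: "{p ! i, p ! (Suc i mod ?n)} = (if Suc i < ?n then {p ! i, p ! Suc i} else {u, v})"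
    if "i < ?n" for i
  proof (cases "Suc i = ?n")
    case True
    then have "i = ?n - 1" by simp
    with True hl show ?thesis by (simp add: insert_commute)
  qed (use that in simp)
  have "{p ! (?n - 1), p ! (Suc (?n - 1) mod ?n)} \<in> edges Q" using n by (auto simp: Q_def)
  moreover have "?n - 1 < ?n" "\<not> Suc (?n - 1) < ?n" using n by auto
  ultimately have last: "{u, v} \<in> edges Q" using e[of "?n - 1"] by (simp only: if_False)
  have in_cases: "x = {u, v} \<or> x \<in> edges G - F" if "x \<in> edges Q" for x
  proof -
    obtain i where "i < ?n" "x = {p ! i, p ! (Suc i mod ?n)}" using \<open>x \<in> edges Q\<close> by (auto simp: Q_def)
    then show ?thesis using e[of i] suc[of i] by (auto split: if_splits)
  qed
  have "edges Q \<subseteq> edges G" using in_cases G(2) by blast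
  moreover have "verts Q \<subseteq> verts G" using p(1) by (simp add: Q_def graph_path_def del_edges_def)
  ultimately have "subgraph Q G" by (simp add: subgraph_def)
  then have "cycle_of G Q" using tr by (auto simp: cycle_of_def)
  moreover have "edges Q \<inter> F = {{u, v}}" using last in_cases j(2) by blast
  ultimately show thesis by (rule that)
qed

text \<open>A path closing up an arc in \<open>J\<close> would yield a cycle that meets \<open>one_way J\<close> exactly once.\<close>

lemma arc_not_closed_up:
  fixes G :: "'a graph"
  assumes G: "simple_graph G" "cycle_basis G P"
    and C: "simple_graph C" "subgraph C G" "finite (edge_boundary G C)"
    and J: "arc_closed G P C J" "(u, v) \<in> J" "joined (del_edges G (arc_edges J)) u v"
  shows "(v, u) \<in> J"
proof (rule ccontr)
  assume *: "(v, u) \<notin> J"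
  have sub: "one_way J \<subseteq> edge_boundary G C"
    using one_way_subset arc_edges_boundary[OF J(1)] by blast
  then have fin: "finite (one_way J)" using C(3) finite_subset by blast
  have uv: "{u, v} \<in> one_way J" using J(2) * by (simp add: one_way_iff)
  then have "{u, v} \<in> edges G" using sub by (auto simp: edge_boundary_def)
  moreover have "joined (del_edges G (one_way J)) u v"
    by (rule joined_mono[OF J(3)]) (use one_way_subset in \<open>auto simp: del_edges_def\<close>)
  ultimately obtain Q where Q: "cycle_of G Q" "edges Q \<inter> one_way J = {{u, v}}"
    using path_plus_edge_cycle[OF G(1) _ _ uv] by blast
  have "(indicator (edges Q) :: 'a set \<Rightarrow> bit) \<in> cycle_space G"
    unfolding cycle_space_def using Q(1) by (intro edge_space.span_base) blast
  then have "(\<Sum>e\<in>one_way J. indicator (edges Q) e) = (0 :: bit)"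
  proof (rule cycle_space_orthogonal[OF G(2)])
    fix Q' assume "Q' \<in> P"
    then show "(\<Sum>e\<in>one_way J. indicator (edges Q') e) = (0 :: bit)"
      using one_way_even[OF C(1,2) _ _ J(1) fin] G(2) by (auto simp: cycle_basis_def)
  qed
  then show False using fin Q(2) by (simp add: sum_indicator_of_nat Int_commute)
qed

section \<open>Interfaces\<close>

locale rooted_graph =
  fixes G :: "'a graph" and P :: "'a graph set" and v\<^sub>0 :: 'a
  assumes simple: "simple_graph G" and infinite_verts: "infinite (verts G)"
    and conn: "connected_graph G" and one_ended: "one_ended G" and deg: "bounded_degree G"
    and root: "v\<^sub>0 \<in> verts G" and unpinched: "unpinched G v\<^sub>0" and basis: "cycle_basis G P"
begin

text \<open>All vertices are kept, so that one-vertex P-paths are paths of the core even if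
  \<open>IO\<close> is empty.\<close>

abbreviation core :: "'a set set \<Rightarrow> 'a graph" where
  "core IO \<equiv> \<lparr>verts = verts G, edges = IO\<rparr>"

lemma simple_core: "IO \<subseteq> edges G \<Longrightarrow> simple_graph (core IO)"
  by (rule simple_graph_subset[OF simple]) simp_all

lemma simple_del: "simple_graph (del_edges G F)"
  by (rule simple_graph_del_edges[OF simple])

lemma joined_all: "u \<in> verts G \<Longrightarrow> v \<in> verts G \<Longrightarrow> joined G u v"
  using conn by (simp add: connected_graph_def)

lemma interfaceD:
  assumes "interface G P v\<^sub>0 (IV, IO)"
  shows "IV \<subseteq> edges G" "IO \<subseteq> edges G" "separates_from_infinity G IV v\<^sub>0"
    "\<exists>D. interface_component G IV D"
    "interface_component G IV D \<Longrightarrow> F_connected G P IV (arcs_into IV D)"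
    "interface_component G IV D \<Longrightarrow>
      IO = {e \<in> edges D. \<exists>p. P_path_edge_to (del_edges G IV) P p e (arcs_into IV D)}"
  using assms unfolding interface.simps by blast+

lemma interface_componentD:
  assumes "interface_component G IV D"
  shows "x \<in> verts D \<Longrightarrow> D = component (del_edges G IV) x" "finite (verts D)"
    "e \<in> IV \<Longrightarrow> e \<inter> verts D \<noteq> {}"
  using assms graph_component_eq[OF simple_del] unfolding interface_component_def by blast+

text \<open>By \<open>P_path_step\<close>, every edge of the path is followed by a shorter P-path to
  the same arc \<open>b\<close>, so clause (4) puts that edge into \<open>IO\<close>. The walk
  cannot leave \<open>D\<close>, which is a component of \<open>G - IV\<close>.\<close>

lemma P_path_in_core:
  assumes I: "interface G P v\<^sub>0 (IV, IO)" and D: "interface_component G IV D"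
    and p: "P_path (del_edges G IV) P p (v, w) b" "b \<in> arcs_into IV D" "w \<in> verts D"
  shows "graph_path (core IO) p"
  using p
proof (induction p arbitrary: v w)
  case Nil
  then show ?case by (simp add: P_path_def graph_path_def)
next
  case (Cons u p)
  have u: "u = w" using Cons.prems(1) by (simp add: P_path_def)
  have gp: "graph_path (del_edges G IV) (w # p)" using Cons.prems(1) u by (simp add: P_path_def)
  show ?case
  proof (cases p)
    case Nil
    then show ?thesis using gp u by (simp add: graph_path_def del_edges_def)
  next
    case (Cons w' q)
    note D' = interface_componentD(1)[OF D Cons.prems(3)]
    have step: "P_path (del_edges G IV) P p (w, w') b"
      using P_path_step[of _ P w w' q] Cons.prems(1) u Cons by simp
    have "{w, w'} \<in> edges (del_edges G IV)" using graph_path_step(1) gp Cons by metis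
    moreover have "w \<in> verts (component (del_edges G IV) w)" using D' Cons.prems(3) by simp
    ultimately have e: "{w, w'} \<in> edges D" using component_edge[OF simple_del] D' by metis
    then have "w' \<in> verts D" using D' by auto
    then have "graph_path (core IO) p" using Cons.IH step Cons.prems(2) by blast
    moreover have "{w, w'} \<in> IO"
      unfolding interfaceD(6)[OF I D] P_path_edge_to_def using e step Cons.prems(2) by blast
    ultimately show ?thesis
      using gp u Cons by (simp add: graph_path_def del_edges_def)
  qed
qed

text \<open>Split the arcs by whether their head is joined to that of \<open>a\<close> in the core.
  A P-path between the two parts, given by clause (3), would lie in the core and join heads from
  different parts.\<close>

lemma arc_heads_joined:
  assumes I: "interface G P v\<^sub>0 (IV, IO)" and D: "interface_component G IV D"
    and ab: "a \<in> arcs_into IV D" "b \<in> arcs_into IV D"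
  shows "joined (core IO) (snd a) (snd b)"
proof (rule ccontr)
  assume nj: "\<not> joined (core IO) (snd a) (snd b)"
  let ?J = "arcs_into IV D"
  let ?J1 = "{x \<in> ?J. joined (core IO) (snd a) (snd x)}"
  have s: "simple_graph (core IO)" using simple_core interfaceD(2)[OF I] .
  have ver: "w \<in> verts G" if "(v, w) \<in> ?J" for v w
    using that simple_graph_edgeD(2)[OF simple] interfaceD(1)[OF I] by (auto simp: arcs_into_def)
  have "joined (core IO) (snd a) (snd a)"
    using ver[of "fst a" "snd a"] ab(1) by (simp add: joined_refl)
  then have "a \<in> ?J1" "b \<in> ?J - ?J1" using ab nj by simp_all
  then have ne: "?J1 \<noteq> {}" "?J - ?J1 \<noteq> {}" by (metis empty_iff)+
  have part: "?J1 \<inter> (?J - ?J1) = {}" "?J1 \<union> (?J - ?J1) = ?J" by auto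
  have "\<exists>x\<in>?J1. \<exists>y\<in>?J - ?J1. \<exists>p. P_path (del_edges G IV) P p x y"
    by (rule interfaceD(5)[OF I D, unfolded F_connected_def, rule_format]) (intro conjI ne part)
  then obtain x y p where xy: "x \<in> ?J1" "y \<in> ?J - ?J1" "P_path (del_edges G IV) P p x y"
    by (elim bexE exE)
  obtain v w where x: "x = (v, w)" by (cases x)
  have "w \<in> verts D" using xy(1) x by (simp add: arcs_into_def)
  then have "graph_path (core IO) p" using P_path_in_core[OF I D, of p v w y] xy x by simp
  then have "joined (core IO) w (snd y)"
    using xy(3) x unfolding joined_def P_path_def by auto
  then have "joined (core IO) (snd a) (snd y)" using xy(1) x joined_trans[OF s, of "snd a" w] by simp
  then show False using xy(2) by simp
qed

text \<open>Together with \<open>arc_heads_joined\<close> this puts the edges of \<open>IO\<close>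
  and the heads of all arcs into one component of the core, so an occurring interface sees a single
  cluster.\<close>

lemma core_edge_joined:
  assumes I: "interface G P v\<^sub>0 (IV, IO)" and D: "interface_component G IV D"
    and e: "e \<in> IO" "x \<in> e" "b \<in> arcs_into IV D"
  shows "joined (core IO) x (snd b)"
proof -
  have s: "simple_graph (core IO)" using simple_core interfaceD(2)[OF I] .
  obtain v w b' p where b': "e \<in> edges D" "e = {v, w}" "b' \<in> arcs_into IV D"
      "P_path (del_edges G IV) P p (v, w) b'"
    using e(1) unfolding interfaceD(6)[OF I D] P_path_edge_to_def by blast
  obtain d where "D = component (del_edges G IV) d"
    using D unfolding interface_component_def graph_components_def by blast
  then have "w \<in> verts D" using b'(1,2) by simp
  then have "graph_path (core IO) p" using P_path_in_core[OF I D b'(4,3)] by simp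
  then have "joined (core IO) w (snd b')" using b'(4) unfolding joined_def P_path_def by auto
  then have w: "joined (core IO) w (snd b)"
    using joined_trans[OF s _ arc_heads_joined[OF I D b'(3) e(3)]] by simp
  have "joined (core IO) v w" using joined_edge[OF s] e(1) b'(2) by simp
  then have "joined (core IO) v (snd b)" using w by (rule joined_trans[OF s])
  then show ?thesis using w e(2) b'(2) by blast
qed

lemma arc_exists:
  assumes I: "interface G P v\<^sub>0 (IV, IO)" and D: "interface_component G IV D" and e: "e \<in> IV"
  obtains v z where "e = {v, z}" "(v, z) \<in> arcs_into IV D"
proof -
  obtain x where x: "x \<in> e" "x \<in> verts D" using interface_componentD(3)[OF D e] by blast
  have "e \<in> edges G" using interfaceD(1)[OF I] e by blast
  then obtain v where "e = {x, v}" using edge_otherE[OF simple _ x(1)] by blast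
  then have "e = {v, x}" by blast
  then show thesis using that e x(2) by (simp add: arcs_into_def)
qed

lemma arcs_nonempty:
  assumes "interface G P v\<^sub>0 (IV, IO)" "interface_component G IV D" "IV \<noteq> {}"
  shows "arcs_into IV D \<noteq> {}"
  using assms(3) arc_exists[OF assms(1,2)] by (metis equals0D ex_in_conv)

lemma vacant_nonempty:
  assumes "interface G P v\<^sub>0 (IV, IO)"
  shows "IV \<noteq> {}"
proof
  assume "IV = {}"
  moreover have "del_edges G {} = G" by (simp add: del_edges_def)
  ultimately have "finite {x. joined G v\<^sub>0 x}"
    using interfaceD(3)[OF assms] by (simp add: separates_from_infinity_def)
  moreover have "verts G \<subseteq> {x. joined G v\<^sub>0 x}" using joined_all[OF root] by blast
  ultimately show False using infinite_verts finite_subset by blast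
qed

section \<open>Interfaces with empty \<open>IO\<close> and the nondegenerate root\<close>

lemma root_complement_joined:
  assumes "x \<in> verts G" "y \<in> verts G" "x \<noteq> v\<^sub>0" "y \<noteq> v\<^sub>0"
  shows "joined (del_verts G {v\<^sub>0}) x y"
  using unpinched assms unfolding unpinched_def connected_graph_def by (simp add: del_verts_def)

text \<open>Without edges in the core all arcs have the same head \<open>z\<close>, so
  \<open>IV\<close> consists of edges at \<open>z\<close>. If \<open>z\<close> were not the root,
  deleting \<open>z\<close> would leave the root in an infinite component. If an edge at the root
  were missing from \<open>IV\<close>, the root would reach every vertex through it, as the graph
  without the root is connected. Either contradicts clause (1).\<close>

lemma empty_core:
  assumes I: "interface G P v\<^sub>0 (IV, {})" and D: "interface_component G IV D"
  shows "IV = {e \<in> edges G. v\<^sub>0 \<in> e}" "verts D = {v\<^sub>0}"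
proof -
  obtain e where e: "e \<in> IV" using vacant_nonempty[OF I] by blast
  obtain u z where z: "(u, z) \<in> arcs_into IV D" using arc_exists[OF I D e] by blast
  have zG: "z \<in> verts G"
    using z simple_graph_edgeD(2)[OF simple] interfaceD(1)[OF I] by (auto simp: arcs_into_def)
  have heads: "w = z" if "(v, w) \<in> arcs_into IV D" for v w
  proof -
    have "joined (core {}) z w" using arc_heads_joined[OF I D z that] by simp
    then have "w \<in> {z}" by (rule joined_closed) auto
    then show ?thesis by simp
  qed
  have at_z: "z \<in> e" if "e \<in> IV" for e
    using arc_exists[OF I D that] heads by (metis insert_iff)
  have fin: "finite {x. joined (del_edges G IV) v\<^sub>0 x}"
    using interfaceD(3)[OF I] by (simp add: separates_from_infinity_def)
  have "z = v\<^sub>0"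
  proof (rule ccontr)
    assume "z \<noteq> v\<^sub>0"
    then have "infinite {x. joined (del_verts G {z}) v\<^sub>0 x}"
      using unpinched zG by (simp add: unpinched_def)
    moreover have "joined (del_edges G IV) v\<^sub>0 x" if "joined (del_verts G {z}) v\<^sub>0 x" for x
      using that by (rule joined_mono) (use at_z in \<open>auto simp: del_verts_def del_edges_def\<close>)
    then have "{x. joined (del_verts G {z}) v\<^sub>0 x} \<subseteq> {x. joined (del_edges G IV) v\<^sub>0 x}" by blast
    ultimately show False using fin finite_subset by blast
  qed
  show IV: "IV = {e \<in> edges G. v\<^sub>0 \<in> e}"
  proof (rule ccontr)
    assume "IV \<noteq> {e \<in> edges G. v\<^sub>0 \<in> e}"
    then obtain e where e: "e \<in> edges G" "v\<^sub>0 \<in> e" "e \<notin> IV"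
      using at_z \<open>z = v\<^sub>0\<close> interfaceD(1)[OF I] by blast
    obtain x where x: "e = {v\<^sub>0, x}" "x \<in> verts G" "x \<noteq> v\<^sub>0"
      using edge_otherE[OF simple e(1,2)] .
    have s1: "joined (del_edges G IV) v\<^sub>0 x"
      using e x joined_edge[OF simple_del] by (simp add: del_edges_def)
    have "joined (del_edges G IV) v\<^sub>0 y" if y: "y \<in> verts G" for y
    proof (cases "y = v\<^sub>0")
      case True
      then show ?thesis using root by (simp add: joined_refl del_edges_def)
    next
      case False
      have "joined (del_edges G IV) x y"
        by (rule joined_mono[OF root_complement_joined[OF x(2) y x(3) False]])
          (use at_z \<open>z = v\<^sub>0\<close> in \<open>auto simp: del_verts_def del_edges_def\<close>)
      then show ?thesis by (rule joined_trans[OF simple_del s1])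
    qed
    then have "verts G \<subseteq> {x. joined (del_edges G IV) v\<^sub>0 x}" by blast
    then show False using fin infinite_verts finite_subset by blast
  qed
  have "z \<in> verts D" using z by (simp add: arcs_into_def)
  then have "D = component (del_edges G IV) v\<^sub>0"
    using interface_componentD(1)[OF D] \<open>z = v\<^sub>0\<close> by simp
  moreover have "x = v\<^sub>0" if "joined (del_edges G IV) v\<^sub>0 x" for x
  proof -
    have "x \<in> {v\<^sub>0}" using that by (rule joined_closed) (auto simp: IV del_edges_def)
    then show ?thesis by simp
  qed
  ultimately show "verts D = {v\<^sub>0}" using joined_refl[of v\<^sub>0 "del_edges G IV"] root
    by (auto simp: del_edges_def)
qed

section \<open>The cluster of an occurring interface\<close>

text \<open>The common ground of both directions: an occurring interface fits the cluster at the
  heads of its arcs, and the interface built from a finite cluster fits that cluster. Unlike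
  \<open>meets\<close>, it does not single out the case of empty \<open>IO\<close>.\<close>

definition fits :: "'a set set \<Rightarrow> 'a set set \<Rightarrow> 'a graph \<Rightarrow> 'a graph \<Rightarrow> bool" where
  "fits IV IO D C \<longleftrightarrow> interface G P v\<^sub>0 (IV, IO) \<and> interface_component G IV D \<and>
     verts C \<subseteq> verts D \<and> snd ` arcs_into IV D \<subseteq> verts C \<and>
     IO \<subseteq> edges C \<and> IV \<subseteq> edge_boundary G C"

lemma fits_meets:
  assumes F: "fits IV IO D C" and C: "simple_graph C"
  shows "meets G (IV, IO) C"
proof (cases "IO = {}")
  case True
  have I: "interface G P v\<^sub>0 (IV, {})" and D: "interface_component G IV D"
    and CD: "verts C \<subseteq> verts D" "snd ` arcs_into IV D \<subseteq> verts C"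
    using F True by (simp_all add: fits_def)
  obtain a where "a \<in> arcs_into IV D"
    using arcs_nonempty[OF I D vacant_nonempty[OF I]] by blast
  then have "snd a \<in> verts C" using CD(2) by auto
  then have v: "verts C = {v\<^sub>0}" using CD(1) unfolding empty_core(2)[OF I D] by auto
  then have "edges C = {}" using C unfolding simple_graph_def by (metis equals0I singletonD)
  then show ?thesis using empty_core(1)[OF I D] v True by (auto simp: edge_boundary_def)
next
  case False
  then show ?thesis using F by (auto simp: fits_def)
qed

lemma cluster_simple: "C \<in> clusters G \<omega> \<Longrightarrow> simple_graph C"
  unfolding clusters_def graph_components_def
  by (elim imageE) (simp only: simple_graph_component simple_graph_occupied[OF simple])

lemma cluster_eqI:
  assumes "C \<in> clusters G \<omega>" "C' \<in> clusters G \<omega>" "x \<in> verts C" "x \<in> verts C'"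
  shows "C = C'"
  using assms graph_component_eq[OF simple_graph_occupied[OF simple]] unfolding clusters_def by metis

lemma cluster_edges:
  assumes "C \<in> clusters G \<omega>" "e \<in> edges C"
  shows "\<omega> e = 1"
  using assms unfolding clusters_def graph_components_def by (auto simp: occupied_graph_def)

text \<open>The occupied edges of \<open>IO\<close> hold the heads of all arcs in one cluster; the
  vacant edges of \<open>IV\<close> confine that cluster to \<open>D\<close>.\<close>

lemma occurring_interface_fits:
  assumes I: "interface G P v\<^sub>0 (IV, IO)" and D: "interface_component G IV D"
    and o: "occurs \<omega> (IV, IO)"
  shows "\<exists>C\<in>clusters G \<omega>. fits IV IO D C"
proof -
  let ?O = "occupied_graph G \<omega>"
  have sO: "simple_graph ?O" by (rule simple_graph_occupied[OF simple])
  have core: "joined ?O x y" if "joined (core IO) x y" for x y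
    by (rule joined_mono[OF that])
      (use o interfaceD(2)[OF I] in \<open>auto simp: occupied_graph_def\<close>)
  obtain e where e: "e \<in> IV" using vacant_nonempty[OF I] by blast
  obtain u z where z: "(u, z) \<in> arcs_into IV D" using arc_exists[OF I D e] by blast
  then have zG: "z \<in> verts G"
    using simple_graph_edgeD(2)[OF simple] interfaceD(1)[OF I] by (auto simp: arcs_into_def)
  define C where "C = component ?O z"
  have heads: "snd a \<in> verts C" if "a \<in> arcs_into IV D" for a
    using core[OF arc_heads_joined[OF I D z that]] by (simp add: C_def)
  have "z \<in> verts D" using z by (simp add: arcs_into_def)
  then have Dz: "D = component (del_edges G IV) z" using interface_componentD(1)[OF D] by simp
  have "joined (del_edges G IV) z x" if "joined ?O z x" for x
    by (rule joined_mono[OF that]) (use o in \<open>auto simp: occupied_graph_def del_edges_def\<close>)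
  then have "verts C \<subseteq> verts D" by (auto simp: C_def Dz)
  moreover have "IO \<subseteq> edges C"
  proof
    fix e assume e: "e \<in> IO"
    have "x \<in> verts C" if "x \<in> e" for x
      using joined_sym[OF core[OF core_edge_joined[OF I D e that z]]] by (simp add: C_def)
    moreover have "e \<in> edges ?O" using e o interfaceD(2)[OF I] by (auto simp: occupied_graph_def)
    ultimately show "e \<in> edges C" by (auto simp: C_def)
  qed
  moreover have C: "C \<in> clusters G \<omega>"
    unfolding C_def clusters_def
    by (rule component_in_graph_components) (simp add: occupied_graph_def zG)
  moreover have "IV \<subseteq> edge_boundary G C"
  proof
    fix e assume e: "e \<in> IV"
    then obtain v x where vx: "e = {v, x}" "(v, x) \<in> arcs_into IV D" using arc_exists[OF I D] by blast
    have "e \<notin> edges C" using cluster_edges[OF C, of e] o e by auto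
    then show "e \<in> edge_boundary G C"
      using e interfaceD(1)[OF I] heads[OF vx(2)] vx(1) by (auto simp: edge_boundary_def)
  qed
  ultimately show ?thesis using I D heads unfolding fits_def by blast
qed

lemma fits_finite: "fits IV IO D C \<Longrightarrow> finite (verts C)"
  unfolding fits_def using interface_componentD(2) finite_subset by blast

lemma fits_separates:
  assumes "fits IV IO D C"
  shows "separates_from_infinity G (edge_boundary G C) v\<^sub>0"
proof -
  have sub: "IV \<subseteq> edge_boundary G C" and I: "interface G P v\<^sub>0 (IV, IO)"
    using assms by (simp_all add: fits_def)
  have "joined (del_edges G IV) v\<^sub>0 x" if "joined (del_edges G (edge_boundary G C)) v\<^sub>0 x" for x
    by (rule joined_mono[OF that]) (use sub in \<open>auto simp: del_edges_def\<close>)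
  then have "verts (component (del_edges G (edge_boundary G C)) v\<^sub>0)
      \<subseteq> verts (component (del_edges G IV) v\<^sub>0)" by auto
  then show ?thesis
    using interfaceD(3)[OF I] unfolding separates_from_infinity_def by (rule finite_subset)
qed

text \<open>A common edge identifies the cluster if \<open>IO\<close> is nonempty. Otherwise
  \<open>C'\<close> is a single vertex \<open>c\<close> whose incident edges are exactly those of
  the root. If \<open>c\<close> were not the root, it would be isolated after deletion of the root,
  against connectedness of the rest.\<close>

lemma met_cluster_unique:
  assumes F: "fits IV IO D C" and C: "C \<in> clusters G \<omega>"
    and C': "C' \<in> clusters G \<omega>" "meets G (IV, IO) C'"
  shows "C' = C"
proof (cases "IO = {}")
  case False
  then obtain e where e: "e \<in> IO" "e \<in> edges C'" using C'(2) by auto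
  then have "e \<in> edges C" using F by (auto simp: fits_def)
  moreover obtain x where "x \<in> e" "x \<in> verts C" "x \<in> verts C'"
    using calculation e(2) cluster_simple[OF C] cluster_simple[OF C'(1)]
    unfolding simple_graph_def by (metis doubleton_eq_iff insertI1)
  ultimately show ?thesis using cluster_eqI[OF C'(1) C] by blast
next
  case True
  have I: "interface G P v\<^sub>0 (IV, {})" and D: "interface_component G IV D"
    and CD: "verts C \<subseteq> verts D" "snd ` arcs_into IV D \<subseteq> verts C"
    using F True by (simp_all add: fits_def)
  obtain a where "a \<in> arcs_into IV D"
    using arcs_nonempty[OF I D vacant_nonempty[OF I]] by blast
  then have "snd a \<in> verts C" using CD(2) by auto
  then have v: "v\<^sub>0 \<in> verts C" using CD(1) unfolding empty_core(2)[OF I D] by auto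
  have E: "edges C' = {}" "IV = edge_boundary G C'" using C'(2) True by auto
  obtain c where c: "c \<in> verts G" "C' = component (occupied_graph G \<omega>) c"
    using C'(1) unfolding clusters_def graph_components_def by (auto simp: occupied_graph_def)
  have "x = c" if "x \<in> verts C'" for x
  proof -
    have "joined (occupied_graph G \<omega>) c x" using that c(2) by simp
    then have "joined C' c x"
      using joined_component[OF simple_graph_occupied[OF simple]] c(2) by simp
    then have "x \<in> {c}" by (rule joined_closed) (auto simp: E)
    then show ?thesis by simp
  qed
  moreover have "c \<in> verts C'" using c by (simp add: joined_refl occupied_graph_def)
  ultimately have vC': "verts C' = {c}" by blast
  then have IVc: "IV = {e \<in> edges G. c \<in> e}" using E by (auto simp: edge_boundary_def)
  have "c = v\<^sub>0"
  proof (rule ccontr)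
    assume "c \<noteq> v\<^sub>0"
    have "infinite (verts G - {v\<^sub>0, c})" using infinite_verts by simp
    then obtain w where w: "w \<in> verts G - {v\<^sub>0, c}" by (metis finite.emptyI equals0I)
    then have "joined (del_verts G {v\<^sub>0}) c w"
      using root_complement_joined c(1) \<open>c \<noteq> v\<^sub>0\<close> by simp
    then have "w \<in> {c}"
    proof (rule joined_closed)
      fix a b assume ab: "{a, b} \<in> edges (del_verts G {v\<^sub>0})" "a \<in> {c}"
      then have "{a, b} \<in> IV" by (auto simp: IVc del_verts_def)
      then have "v\<^sub>0 \<in> {a, b}" using empty_core(1)[OF I D] by blast
      then show "b \<in> {c}" using ab(1) by (auto simp: del_verts_def)
    qed simp
    then show False using w by simp
  qed
  then show ?thesis using cluster_eqI[OF C'(1) C] vC' v by simp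
qed

end

section \<open>Boundary arcs of a finite connected subgraph and the infinite component of its
  complement\<close>

locale finite_subgraph = rooted_graph G P v\<^sub>0
  for G :: "'a graph" and P :: "'a graph set" and v\<^sub>0 :: 'a +
  fixes C X :: "'a graph"
  assumes simple_C: "simple_graph C" and conn_C: "connected_graph C"
    and finite_C: "finite (verts C)" and sub: "subgraph C G"
    and X: "X \<in> graph_components (del_verts G (verts C))" "infinite (verts X)"
      "finite (verts G - verts X)"
begin

abbreviation bd :: "'a set set" where "bd \<equiv> edge_boundary G C"

text \<open>\<open>C\<close> need not be induced: an edge outside \<open>C\<close> with both ends in
  \<open>C\<close> contributes both of its directions.\<close>

abbreviation arcs :: "('a \<times> 'a) set" where "arcs \<equiv> arcs_into bd C"

lemma finite_bd: "finite bd"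
  using finite_edge_boundary[OF deg finite_C] sub by (simp add: subgraph_def)

lemma bd_iff: "{u, v} \<in> bd \<longleftrightarrow> {u, v} \<in> edges G \<and> {u, v} \<notin> edges C \<and> (u \<in> verts C \<or> v \<in> verts C)"
  by (auto simp: edge_boundary_def)

lemma arcs_iff: "(u, v) \<in> arcs \<longleftrightarrow> {u, v} \<in> edges G \<and> {u, v} \<notin> edges C \<and> v \<in> verts C"
  by (auto simp: arcs_into_def bd_iff)

lemma bd_touches: "e \<in> bd \<Longrightarrow> e \<inter> verts C \<noteq> {}"
  by (simp add: edge_boundary_def)

lemma X_eq: "x \<in> verts X \<Longrightarrow> X = component (del_verts G (verts C)) x"
  using graph_component_eq[OF simple_graph_del_verts[OF simple] X(1)] .

lemma X_disjoint: "x \<in> verts X \<Longrightarrow> x \<in> verts G \<and> x \<notin> verts C"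
  using X_eq[of x] joined_verts(1)[of "del_verts G (verts C)" x x] by (auto simp: del_verts_def)

lemma X_exit:
  assumes "{x, z} \<in> edges G" "x \<in> verts X" "z \<notin> verts X"
  shows "z \<in> verts C" "(x, z) \<in> arcs"
proof -
  let ?H = "del_verts G (verts C)"
  have "joined ?H x x" "\<not> joined ?H x z" using assms X_eq[OF assms(2)] by auto
  then show "z \<in> verts C" by (rule component_edge_leaving[OF simple assms(1)])
  then show "(x, z) \<in> arcs"
    using assms X_disjoint[OF assms(2)] simple_graph_edgeD(1)[OF simple_C, of x z] by (auto simp: arcs_iff)
qed

lemma joined_in_X:
  assumes "x \<in> verts X" "y \<in> verts X" "F \<subseteq> bd"
  shows "joined (del_edges G F) x y"
proof -
  have "joined (del_verts G (verts C)) x y" using X_eq[OF assms(1)] assms(2) by auto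
  then show ?thesis
    by (rule joined_mono) (use bd_touches assms(3) in \<open>auto simp: del_verts_def del_edges_def\<close>)
qed

lemma joined_in_C:
  assumes "x \<in> verts C" "y \<in> verts C" "F \<subseteq> bd"
  shows "joined (del_edges G F) x y"
proof -
  have "joined C x y" using conn_C assms by (simp add: connected_graph_def)
  then show ?thesis
    by (rule joined_mono) (use sub assms(3) in \<open>auto simp: del_edges_def subgraph_def edge_boundary_def\<close>)
qed

lemma X_arc: "\<exists>x z. (x, z) \<in> arcs \<and> x \<in> verts X"
proof -
  obtain x where x: "x \<in> verts X" using X(2) by (metis finite.emptyI equals0I)
  obtain c where c: "c \<in> verts C" using conn_C by (auto simp: connected_graph_def)
  have cG: "c \<in> verts G" using c sub by (auto simp: subgraph_def)
  have "c \<notin> verts X" using X_disjoint c by blast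
  then obtain a b where "{a, b} \<in> edges G" "a \<in> verts X" "b \<notin> verts X"
    using edge_leaving[OF conn, of x "verts X" c] x X_disjoint[OF x] cG by blast
  then show ?thesis using X_exit(2) by blast
qed

lemma closed_up:
  assumes "arc_closed G P C J" "(u, v) \<in> J" "joined (del_edges G (arc_edges J)) u v"
  shows "(v, u) \<in> J"
  using arc_not_closed_up[OF simple basis simple_C sub finite_bd assms] .

lemma closed_subset: "arc_closed G P C J \<Longrightarrow> J \<subseteq> arcs"
  by (simp add: arc_closed_def)

text \<open>Otherwise one could go from \<open>x1\<close> through \<open>X\<close> to
  \<open>x2\<close>, cross to \<open>z2\<close> and return through \<open>C\<close> to
  \<open>z1\<close> without using edges of \<open>J\<close>. Closing up would put
  \<open>(z1, x1)\<close> into \<open>J\<close>, but its head \<open>x1\<close> is outside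
  \<open>C\<close>.\<close>

lemma X_arcs_together:
  assumes J: "arc_closed G P C J" "(x1, z1) \<in> J" "x1 \<in> verts X"
    and a2: "(x2, z2) \<in> arcs" "x2 \<in> verts X"
  shows "(x2, z2) \<in> J"
proof (rule ccontr)
  assume not: "(x2, z2) \<notin> J"
  let ?H = "del_edges G (arc_edges J)"
  have sJ: "arc_edges J \<subseteq> bd" using arc_edges_boundary[OF J(1)] .
  have head: "w \<in> verts C" if "(v, w) \<in> J" for v w
    using closed_subset[OF J(1)] that by (auto simp: arcs_iff)
  have "(z2, x2) \<notin> J" using head X_disjoint[OF a2(2)] by blast
  then have "{x2, z2} \<notin> arc_edges J"
    using not by (auto simp: arc_edges_def doubleton_eq_iff)
  then have "{x2, z2} \<in> edges ?H" using a2(1) by (simp add: arcs_iff del_edges_def)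
  then have "joined ?H x2 z2" by (rule joined_edge[OF simple_del])
  then have "joined ?H x1 z2" by (rule joined_trans[OF simple_del joined_in_X[OF J(3) a2(2) sJ]])
  moreover have "joined ?H z2 z1"
    using joined_in_C[OF _ head[OF J(2)] sJ] a2(1) by (simp add: arcs_iff)
  ultimately have "joined ?H x1 z1" by (rule joined_trans[OF simple_del])
  then have "(z1, x1) \<in> J" using closed_up[OF J(1,2)] by blast
  then show False using head X_disjoint[OF J(3)] by blast
qed

lemma stays_outside_X:
  assumes "\<And>x z. (x, z) \<in> arcs \<Longrightarrow> x \<in> verts X \<Longrightarrow> {x, z} \<in> F"
    and "joined (del_edges G F) u w" "u \<notin> verts X"
  shows "w \<notin> verts X"
proof -
  have "w \<in> - verts X" using assms(2)
  proof (rule joined_closed)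
    fix a b assume ab: "{a, b} \<in> edges (del_edges G F)" "a \<in> - verts X"
    show "b \<in> - verts X"
    proof
      assume b: "b \<in> verts X"
      moreover have "{b, a} \<in> edges G" using ab(1) by (simp add: del_edges_def insert_commute)
      ultimately have "(b, a) \<in> arcs" using ab(2) by (intro X_exit(2)) simp_all
      then have "{b, a} \<in> F" using b by (rule assms(1))
      then show False using ab(1) by (simp add: del_edges_def insert_commute)
    qed
  qed (use assms(3) in simp)
  then show ?thesis by simp
qed

section \<open>Existence\<close>

definition linked :: "'a \<times> 'a \<Rightarrow> 'a \<times> 'a \<Rightarrow> bool" where
  "linked a b \<longleftrightarrow> a \<in> arcs \<and> b \<in> arcs \<and> (\<exists>p. P_path (del_edges G bd) P p a b)"

lemma linked_sym: "linked a b \<Longrightarrow> linked b a"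
  unfolding linked_def using P_path_rev by blast

lemma linked_class_closed:
  assumes "a \<in> arcs"
  shows "arc_closed G P C {b. linked\<^sup>*\<^sup>* a b}"
  unfolding arc_closed_def
proof (intro conjI ballI allI impI)
  show "{b. linked\<^sup>*\<^sup>* a b} \<subseteq> arcs"
  proof safe
    fix u v assume "linked\<^sup>*\<^sup>* a (u, v)"
    then show "(u, v) \<in> arcs" by (cases rule: rtranclp.cases) (use assms in \<open>auto simp: linked_def\<close>)
  qed
  then show "b' \<in> {b. linked\<^sup>*\<^sup>* a b}"
    if "b \<in> {b. linked\<^sup>*\<^sup>* a b}" "b' \<in> arcs" "P_path (del_edges G bd) P p b b'" for b b' p
    using that rtranclp.rtrancl_into_rtrancl[of linked a b b'] unfolding linked_def by blast
qed

lemma linked_crossing: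
  assumes "linked\<^sup>*\<^sup>* a b" "a \<in> S" "b \<notin> S"
  obtains x y where "linked\<^sup>*\<^sup>* a x" "x \<in> S" "y \<notin> S" "linked x y"
  using assms by (induction rule: rtranclp_induct) blast+

text \<open>A chain of links from \<open>a\<close> to an element of the other part crosses between
  the parts at some link. Its P-path avoids all of \<open>bd\<close>, hence also
  \<open>IV\<close>.\<close>

lemma class_F_connected:
  assumes "a \<in> arcs" "IV \<subseteq> bd"
  shows "F_connected G P IV {b. linked\<^sup>*\<^sup>* a b}"
  unfolding F_connected_def
proof (intro allI impI, elim conjE)
  let ?J = "{b. linked\<^sup>*\<^sup>* a b}"
  fix J1 J2 assume ne: "J1 \<noteq> {}" "J2 \<noteq> {}" and dis: "J1 \<inter> J2 = {}" "J1 \<union> J2 = ?J"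
  have cross: "\<exists>x\<in>K. \<exists>y\<in>L. linked x y" if KL: "a \<in> K" "L \<noteq> {}" "K \<inter> L = {}" "K \<union> L = ?J" for K L
  proof -
    obtain b where b: "b \<in> L" using KL(2) by blast
    then have "linked\<^sup>*\<^sup>* a b" "b \<notin> K" using KL by blast+
    then obtain x y where xy: "linked\<^sup>*\<^sup>* a x" "x \<in> K" "y \<notin> K" "linked x y"
      using KL(1) linked_crossing by metis
    then have "y \<in> ?J" using rtranclp.rtrancl_into_rtrancl[of linked a x y] by simp
    then show ?thesis using xy KL by blast
  qed
  have "a \<in> ?J" by simp
  then have "\<exists>x\<in>J1. \<exists>y\<in>J2. linked x y"
  proof (cases "a \<in> J1")
    case False
    then have "a \<in> J2" using dis \<open>a \<in> ?J\<close> by blast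
    then show ?thesis using cross[of J2 J1] ne dis linked_sym by (metis Int_commute Un_commute)
  qed (use cross[of J1 J2] ne dis in blast)
  then obtain x y p where "x \<in> J1" "y \<in> J2" and p: "P_path (del_edges G bd) P p x y"
    unfolding linked_def by blast
  moreover have "P_path (del_edges G IV) P p x y"
    by (rule P_path_mono[OF p]) (use assms(2) in \<open>auto simp: del_edges_def\<close>)
  ultimately show "\<exists>x\<in>J1. \<exists>y\<in>J2. \<exists>p. P_path (del_edges G IV) P p x y" by blast
qed

text \<open>Otherwise the first edge outside \<open>C\<close> on the way back from \<open>b\<close> would belong to \<open>J\<close>.\<close>

lemma path_edge_in_C:
  assumes J: "arc_closed G P C J" "b \<in> J"
    and p: "P_path (del_edges G (arc_edges J)) P p (v, w) b" "{v, w} \<in> edges G - arc_edges J"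
  shows "{v, w} \<in> edges C"
proof (rule ccontr)
  assume not: "{v, w} \<notin> edges C"
  let ?H = "del_edges G (arc_edges J)"
  have r: "P_path ?H P (rev p) b (v, w)" using p(1) by (rule P_path_rev)
  obtain Q vs k where Q: "Q \<in> P" "traverses vs Q" "1 \<le> k" "k \<le> length vs" "rev p = take k vs"
      "fst b = last vs" "v = vs ! (k mod length vs)"
    using r unfolding P_path_def by auto
  have ne: "vs \<noteq> []" using Q(3,4) by auto
  have gp: "graph_path ?H (take k vs)" and hl: "hd (take k vs) = snd b" "last (take k vs) = w"
    using r Q(5) by (simp_all add: P_path_def)
  let ?e = "\<lambda>i. {cyc vs i, cyc vs (Suc i)}"
  have H: "?e i \<in> edges ?H" if "Suc i < k" for i
    using gp that Q(4) by (auto simp: graph_path_def successively_conv_nth)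
  have lastk: "cyc vs (k - 1) = w" "cyc vs k = v"
    using hl(2) Q(3,4,7) ne by (auto simp: last_conv_nth cyc_def)
  have Sk: "Suc (k - 1) = k" using Q(3) by simp
  then have ek: "?e (k - 1) = {w, v}" using lastk by simp
  \<comment> \<open>Position \<open>i\<close> carries the first edge outside \<open>C\<close>; the
    edge at \<open>k - 1\<close> is \<open>{w, v}\<close>, so \<open>i\<close> is at most
    \<open>k - 1\<close>. Up to there the reversed path stays in \<open>C\<close>, so the arc at
    \<open>i\<close> is linked to \<open>b\<close>. Its edge is a path edge or
    \<open>{w, v}\<close>, and neither belongs to \<open>arc_edges J\<close>.\<close>
  define i where "i = (LEAST i. ?e i \<notin> edges C)"
  have "?e (k - 1) \<notin> edges C" using ek not by (simp add: insert_commute)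
  then have i: "?e i \<notin> edges C" "i \<le> k - 1" unfolding i_def by (rule LeastI, rule Least_le)
  have below: "?e j \<in> edges C" if "j < i" for j
    using not_less_Least that unfolding i_def by blast
  have "Suc i < k \<or> i = k - 1" using i(2) by linarith
  then have iG: "?e i \<in> edges G - arc_edges J"
  proof
    assume "i = k - 1"
    then show ?thesis using ek p(2) by (simp add: insert_commute)
  qed (use H[of i] in \<open>simp add: del_edges_def\<close>)
  have b: "b \<in> arcs" using J closed_subset by blast
  have c0: "cyc vs 0 = snd b" using hl(1) Q(3) ne by (simp add: hd_conv_nth)
  have sC: "cyc vs i \<in> verts C"
  proof (cases i)
    case 0
    then show ?thesis using b c0 by (cases b) (simp add: arcs_iff)
  next
    case (Suc j)
    then show ?thesis using simple_graph_edgeD(2)[OF simple_C below[of j]] by simp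
  qed
  have a: "(cyc vs (Suc i), cyc vs i) \<in> arcs"
    using iG i(1) sC by (simp add: arcs_iff insert_commute)
  have "cycle_of G Q" using basis Q(1) by (simp add: cycle_basis_def)
  then have setvs: "set vs \<subseteq> verts (del_edges G bd)"
    using Q(2) by (simp add: cycle_of_def subgraph_def traverses_def del_edges_def)
  have "?e j \<in> edges (del_edges G bd)" if "j < i" for j
    using below[OF that] sub by (auto simp: del_edges_def subgraph_def edge_boundary_def)
  moreover have "i < length vs" using i(2) Q(3,4) by linarith
  ultimately obtain q where q: "P_path (del_edges G bd) P q (cyc vs (0 + length vs - 1), cyc vs 0)
      (cyc vs (Suc (0 + i)), cyc vs (0 + i))"
    using P_path_along_cycle[OF Q(1,2) setvs, of i 0] by (metis add_0)
  moreover have "(cyc vs (0 + length vs - 1), cyc vs 0) = b"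
    using Q(6) c0 ne by (cases b) (simp add: last_conv_nth)
  ultimately have "P_path (del_edges G bd) P q b (cyc vs (Suc i), cyc vs i)" by simp
  then have "(cyc vs (Suc i), cyc vs i) \<in> J" using arc_closedD[OF J(1) _ b a] J(2) by blast
  then have "{cyc vs (Suc i), cyc vs i} \<in> arc_edges J" by (auto simp: arc_edges_def)
  then show False using iG by (simp add: insert_commute)
qed

lemma fits_exists:
  assumes sep: "separates_from_infinity G bd v\<^sub>0"
  shows "\<exists>IV IO D. fits IV IO D C"
proof -
  obtain x0 z0 where a0: "(x0, z0) \<in> arcs" "x0 \<in> verts X" using X_arc by blast
  define J where "J = {b. linked\<^sup>*\<^sup>* (x0, z0) b}"
  have J: "arc_closed G P C J" unfolding J_def using a0(1) by (rule linked_class_closed)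
  have aJ: "(x0, z0) \<in> J" by (simp add: J_def)
  define IV where "IV = arc_edges J"
  have IVbd: "IV \<subseteq> bd" unfolding IV_def using J by (rule arc_edges_boundary)
  have out: "{x, z} \<in> IV" if "(x, z) \<in> arcs" "x \<in> verts X" for x z
    using X_arcs_together[OF J aJ a0(2) that] by (auto simp: IV_def arc_edges_def)
  have head: "z \<in> verts C" if "(v, z) \<in> J" for v z
    using closed_subset[OF J] that by (auto simp: arcs_iff)
  have z0: "z0 \<in> verts C" by (rule head[OF aJ])
  have z0G: "z0 \<in> verts G" using z0 sub by (auto simp: subgraph_def)
  define D where "D = component (del_edges G IV) z0"
  \<comment> \<open>By \<open>out\<close>, \<open>IV\<close> contains every edge leaving
    \<open>X\<close>, so a component of \<open>G - IV\<close> that starts outside \<open>X\<close>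
    avoids \<open>X\<close> and is finite.\<close>
  have outside: "verts (component (del_edges G IV) u) \<subseteq> verts G - verts X" if "u \<notin> verts X" for u
  proof
    fix x assume "x \<in> verts (component (del_edges G IV) u)"
    then have j: "joined (del_edges G IV) u x" by simp
    show "x \<in> verts G - verts X"
      using stays_outside_X[OF out j that] joined_verts(2)[OF j] by (simp add: del_edges_def)
  qed
  have "z0 \<notin> verts X" using z0 X_disjoint by blast
  then have "verts D \<subseteq> verts G - verts X" unfolding D_def by (rule outside)
  then have finD: "finite (verts D)" using X(3) by (rule finite_subset)
  have CD: "verts C \<subseteq> verts D" using joined_in_C[OF z0 _ IVbd] by (auto simp: D_def)
  have arcsD: "arcs_into IV D = J"
  proof
    show "J \<subseteq> arcs_into IV D"
      using head CD by (auto simp: arcs_into_def IV_def arc_edges_def)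
    show "arcs_into IV D \<subseteq> J"
    proof safe
      fix v z assume vz: "(v, z) \<in> arcs_into IV D"
      then have z: "{v, z} \<in> IV" "z \<in> verts D" by (auto simp: arcs_into_def)
      show "(v, z) \<in> J"
      \<comment> \<open>The head \<open>z\<close> might lie in \<open>D\<close> but outside
        \<open>C\<close>. If only \<open>(z, v)\<close> were in \<open>J\<close>, then
        \<open>z\<close> would be joined to \<open>v\<close> off \<open>IV\<close> through
        \<open>D\<close>, and closing up would put \<open>(v, z)\<close> into \<open>J\<close> as
        well.\<close>
      proof (rule ccontr)
        assume not: "(v, z) \<notin> J"
        then have zv: "(z, v) \<in> J" using z(1) by (auto simp: IV_def arc_edges_def doubleton_eq_iff)
        have "joined (del_edges G IV) z z0" using z(2) by (simp add: D_def joined_sym)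
        moreover have "joined (del_edges G IV) z0 v" by (rule joined_in_C[OF z0 head[OF zv] IVbd])
        ultimately have "joined (del_edges G IV) z v" by (rule joined_trans[OF simple_del])
        then show False using closed_up[OF J zv] not by (simp add: IV_def)
      qed
    qed
  qed
  have comp: "D \<in> graph_components (del_edges G IV)"
    unfolding D_def by (rule component_in_graph_components) (simp add: del_edges_def z0G)
  have "e \<inter> verts D \<noteq> {}" if "e \<in> IV" for e
    using bd_touches[of e] that IVbd CD by blast
  then have icD: "interface_component G IV D"
    using comp finD by (simp add: interface_component_def)
  have uniq: "D' = D" if D': "interface_component G IV D'" for D'
  proof -
    \<comment> \<open>A competing component contains an end of this edge. With \<open>x0\<close> it
      would contain all of \<open>X\<close>, so it contains \<open>z0\<close>.\<close>
    have "{x0, z0} \<in> IV" using out[OF a0] .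
    then have "{x0, z0} \<inter> verts D' \<noteq> {}" by (rule interface_componentD(3)[OF D'])
    moreover have "x0 \<notin> verts D'"
    proof
      assume "x0 \<in> verts D'"
      then have "D' = component (del_edges G IV) x0" by (rule interface_componentD(1)[OF D'])
      then have "verts X \<subseteq> verts D'" using joined_in_X[OF a0(2) _ IVbd] by auto
      then show False using X(2) interface_componentD(2)[OF D'] finite_subset by blast
    qed
    ultimately have "z0 \<in> verts D'" by blast
    then show "D' = D" unfolding D_def by (rule interface_componentD(1)[OF D'])
  qed
  \<comment> \<open>Here the hypothesis on the boundary of \<open>C\<close> enters: \<open>X\<close>
    stays connected off \<open>bd\<close>, so a root in \<open>X\<close> would have an infinite
    component.\<close>
  have "v\<^sub>0 \<notin> verts X"
  proof
    assume "v\<^sub>0 \<in> verts X"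
    then have "verts X \<subseteq> verts (component (del_edges G bd) v\<^sub>0)"
      using joined_in_X[of v\<^sub>0 _ bd] by auto
    then show False using sep X(2) finite_subset unfolding separates_from_infinity_def by blast
  qed
  then have "verts (component (del_edges G IV) v\<^sub>0) \<subseteq> verts G - verts X" by (rule outside)
  then have sepIV: "separates_from_infinity G IV v\<^sub>0"
    unfolding separates_from_infinity_def using X(3) by (rule finite_subset)
  define IO where "IO = {e \<in> edges D. \<exists>p. P_path_edge_to (del_edges G IV) P p e J}"
  have IOC: "IO \<subseteq> edges C"
  proof
    fix e assume "e \<in> IO"
    then obtain v w b p where e: "e \<in> edges D" "e = {v, w}" "b \<in> J"
        "P_path (del_edges G IV) P p (v, w) b"
      unfolding IO_def P_path_edge_to_def by blast
    have "e \<in> edges G - IV" using e(1) by (simp add: D_def del_edges_def)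
    then show "e \<in> edges C" using path_edge_in_C[OF J e(3)] e(2,4) by (simp add: IV_def)
  qed
  have FC: "F_connected G P IV J" unfolding J_def by (rule class_F_connected[OF a0(1) IVbd])
  have "interface G P v\<^sub>0 (IV, IO)"
    unfolding interface.simps
  proof (intro conjI allI impI)
    show "IV \<subseteq> edges G" using IVbd by (auto simp: edge_boundary_def)
    show "IO \<subseteq> edges G" using IOC sub by (auto simp: subgraph_def)
    show "\<exists>!D. interface_component G IV D" using icD uniq by blast
    fix D' assume "interface_component G IV D'"
    then have "D' = D" by (rule uniq)
    then show "F_connected G P IV (arcs_into IV D')"
      "IO = {e \<in> edges D'. \<exists>p. P_path_edge_to (del_edges G IV) P p e (arcs_into IV D')}"
      using FC arcsD by (simp_all add: IO_def)
  qed (rule sepIV)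
  moreover have "snd ` arcs_into IV D \<subseteq> verts C" unfolding arcsD using head by auto
  ultimately have "fits IV IO D C" unfolding fits_def using icD CD IOC IVbd by (intro conjI)
  then show ?thesis by blast
qed

section \<open>Uniqueness\<close>

text \<open>If a P-path inside \<open>C\<close> led to a boundary arc \<open>b\<close> outside the
  set, the edge of \<open>b\<close> would survive in \<open>D\<close>, and the reversed path would
  connect it to an arc of \<open>IV\<close>. So it would belong to \<open>IO\<close>, hence to
  \<open>C\<close>, which no boundary edge does.\<close>

lemma fits_arcs_closed:
  assumes F: "fits IV IO D C"
  shows "arc_closed G P C (arcs_into IV D)"
proof -
  have I: "interface G P v\<^sub>0 (IV, IO)" and D: "interface_component G IV D"
    and CD: "verts C \<subseteq> verts D" and heads: "snd ` arcs_into IV D \<subseteq> verts C"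
    and IO: "IO \<subseteq> edges C" and IV: "IV \<subseteq> bd"
    using F by (simp_all add: fits_def)
  show ?thesis
    unfolding arc_closed_def
  proof (intro conjI ballI allI impI)
    show "arcs_into IV D \<subseteq> arcs" using heads IV by (force simp: arcs_into_def)
  next
    fix a b p
    assume a: "a \<in> arcs_into IV D" and b: "b \<in> arcs" and p: "P_path (del_edges G bd) P p a b"
    obtain x y where xy: "b = (x, y)" by (cases b)
    have y: "y \<in> verts C" "{x, y} \<in> edges G" "{x, y} \<notin> edges C" using b xy by (auto simp: arcs_iff)
    have yD: "y \<in> verts D" using y(1) CD by blast
    show "b \<in> arcs_into IV D"
    proof (rule ccontr)
      assume "b \<notin> arcs_into IV D"
      then have "{y, x} \<in> edges (del_edges G IV)"
        using xy y yD by (simp add: arcs_into_def del_edges_def insert_commute)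
      moreover have Dy: "D = component (del_edges G IV) y" by (rule interface_componentD(1)[OF D yD])
      moreover have "y \<in> verts (component (del_edges G IV) y)" using yD Dy by metis
      ultimately have e: "{x, y} \<in> edges D" using component_edge[OF simple_del] by (metis insert_commute)
      have "P_path (del_edges G IV) P (rev p) (x, y) a"
        by (rule P_path_mono[OF P_path_rev[OF p, unfolded xy]]) (use IV in \<open>auto simp: del_edges_def\<close>)
      then have "{x, y} \<in> IO"
        unfolding interfaceD(6)[OF I D] P_path_edge_to_def using e a by blast
      then show False using IO y(3) by blast
    qed
  qed
qed

text \<open>Otherwise the edge of the arc survives in \<open>G - IV\<close> and attaches all of
  \<open>X\<close> to the finite component \<open>D\<close>.\<close>

lemma fits_X_arc:
  assumes F: "fits IV IO D C" and a: "(x, z) \<in> arcs" "x \<in> verts X"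
  shows "(x, z) \<in> arcs_into IV D"
proof -
  have D: "interface_component G IV D" and CD: "verts C \<subseteq> verts D" and IV: "IV \<subseteq> bd"
    using F by (simp_all add: fits_def)
  have zC: "z \<in> verts C" using a(1) by (simp add: arcs_iff)
  then have zD: "z \<in> verts D" using CD by blast
  then have Dz: "D = component (del_edges G IV) z" by (rule interface_componentD(1)[OF D])
  show ?thesis
  proof (rule ccontr)
    assume "(x, z) \<notin> arcs_into IV D"
    then have "{x, z} \<notin> IV" using zD by (simp add: arcs_into_def)
    moreover have "{x, z} \<in> edges G" using a(1) by (simp add: arcs_iff)
    ultimately have "{z, x} \<in> edges (del_edges G IV)" by (simp add: del_edges_def insert_commute)
    then have zx: "joined (del_edges G IV) z x" by (rule joined_edge[OF simple_del])
    have "verts X \<subseteq> verts D"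
    proof
      fix y assume "y \<in> verts X"
      then have "joined (del_edges G IV) z y"
        by (rule joined_trans[OF simple_del zx joined_in_X[OF a(2) _ IV]])
      then show "y \<in> verts D" unfolding Dz by simp
    qed
    then show False using X(2) interface_componentD(2)[OF D] finite_subset by blast
  qed
qed

text \<open>Both arc sets contain an arc from \<open>X\<close>, so if the inclusion failed, clause
  (3) would give a P-path from the intersection to the difference. It runs along \<open>IO\<close>,
  hence inside \<open>C\<close>, and closedness of the second set forbids it.\<close>

lemma fits_arcs_subset:
  assumes F: "fits IV IO D C" and F': "fits IV' IO' D' C"
  shows "arcs_into IV D \<subseteq> arcs_into IV' D'"
proof (rule ccontr)
  assume not: "\<not> ?thesis"
  let ?J = "arcs_into IV D" and ?J' = "arcs_into IV' D'"
  have I: "interface G P v\<^sub>0 (IV, IO)" and D: "interface_component G IV D" and IO: "IO \<subseteq> edges C"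
    using F by (simp_all add: fits_def)
  obtain x z where "(x, z) \<in> arcs" "x \<in> verts X" using X_arc by blast
  then have "(x, z) \<in> ?J \<inter> ?J'" using fits_X_arc F F' by blast
  then have ne: "?J \<inter> ?J' \<noteq> {}" "?J - ?J' \<noteq> {}" using not by blast+
  have part: "?J \<inter> ?J' \<inter> (?J - ?J') = {}" "?J \<inter> ?J' \<union> (?J - ?J') = ?J" by auto
  have "\<exists>a\<in>?J \<inter> ?J'. \<exists>b\<in>?J - ?J'. \<exists>p. P_path (del_edges G IV) P p a b"
    by (rule interfaceD(5)[OF I D, unfolded F_connected_def, rule_format]) (intro conjI ne part)
  then obtain a b p where ab: "a \<in> ?J \<inter> ?J'" "b \<in> ?J - ?J'" "P_path (del_edges G IV) P p a b"
    by (elim bexE exE)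
  obtain v w where a: "a = (v, w)" by (cases a)
  have "w \<in> verts D" using ab(1) a by (simp add: arcs_into_def)
  then have "graph_path (core IO) p" using P_path_in_core[OF I D, of p v w b] ab a by simp
  then have "graph_path (del_edges G bd) p"
    by (rule graph_path_mono) (use IO sub in \<open>auto simp: del_edges_def subgraph_def edge_boundary_def\<close>)
  then have p: "P_path (del_edges G bd) P p a b" by (rule P_path_cong[OF ab(3)])
  have "b \<in> arcs" using closed_subset[OF fits_arcs_closed[OF F]] ab(2) by blast
  moreover have "a \<in> arcs" using closed_subset[OF fits_arcs_closed[OF F]] ab(1) by blast
  ultimately have "b \<in> ?J'" using arc_closedD[OF fits_arcs_closed[OF F'] p] ab(1) by simp
  then show False using ab(2) by simp
qed

lemma fits_unique:
  assumes F: "fits IV IO D C" and F': "fits IV' IO' D' C"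
  shows "IV = IV' \<and> IO = IO'"
proof -
  have sub: "K \<subseteq> K'" if "fits K L M C" "fits K' L' M' C" for K L M K' L' M'
  proof
    fix e assume e: "e \<in> K"
    have "interface G P v\<^sub>0 (K, L)" "interface_component G K M" using that(1) by (simp_all only: fits_def)
    then obtain v z where "e = {v, z}" "(v, z) \<in> arcs_into K M" using e by (rule arc_exists)
    then show "e \<in> K'" using fits_arcs_subset[OF that] by (auto simp: arcs_into_def)
  qed
  have IV: "IV = IV'" using sub[OF F F'] sub[OF F' F] by blast
  have I: "interface G P v\<^sub>0 (IV, IO)" "interface_component G IV D"
    using F by (simp_all only: fits_def)
  have I': "interface G P v\<^sub>0 (IV, IO')" using F' by (simp only: fits_def IV)
  \<comment> \<open>Once the vacant parts agree, clause (4) with the same \<open>D\<close> computes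
    both occupied parts.\<close>
  have "IO = IO'" by (rule trans[OF interfaceD(6)[OF I] interfaceD(6)[OF I' I(2), symmetric]])
  then show ?thesis using IV by simp
qed

end

theorem theorem10p4:
  fixes G :: "'a graph" and P :: "'a graph set" and v\<^sub>0 :: 'a and \<omega> :: "'a set \<Rightarrow> nat"
  assumes "simple_graph G" and "infinite (verts G)" and "connected_graph G"
    and "one_ended G" and "bounded_degree G"
    and "v\<^sub>0 \<in> verts G"
    and "unpinched G v\<^sub>0"
    and "cycle_basis G P" and "\<exists>L. \<forall>C\<in>P. card (edges C) \<le> L"
    and "\<omega> \<in> edges G \<rightarrow> {0, 1}"
  shows "(\<forall>C\<in>clusters G \<omega>.
            finite (verts C) \<and> separates_from_infinity G (edge_boundary G C) v\<^sub>0 \<longrightarrow>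
            (\<exists>!I. interface G P v\<^sub>0 I \<and> meets G I C \<and> occurs \<omega> I) \<and>
            (\<forall>IV IO. interface G P v\<^sub>0 (IV, IO) \<and> meets G (IV, IO) C \<and> occurs \<omega> (IV, IO) \<longrightarrow>
               IO \<subseteq> edges C \<and> IV \<subseteq> edge_boundary G C)) \<and>
         (\<forall>I. interface G P v\<^sub>0 I \<and> occurs \<omega> I \<longrightarrow>
            (\<exists>!C. C \<in> clusters G \<omega> \<and> meets G I C) \<and>
            (\<forall>C. C \<in> clusters G \<omega> \<and> meets G I C \<longrightarrow>
               separates_from_infinity G (edge_boundary G C) v\<^sub>0 \<and> finite (verts C)))"
proof -
  interpret rooted_graph G P v\<^sub>0 by standard fact+
  have fit: "\<exists>D. fits IV IO D C"
    if I: "interface G P v\<^sub>0 (IV, IO)" and o: "occurs \<omega> (IV, IO)"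
      and C: "C \<in> clusters G \<omega>" "meets G (IV, IO) C" for IV IO C
  proof -
    obtain D where D: "interface_component G IV D" using interfaceD(4)[OF I] by blast
    obtain C' where C': "C' \<in> clusters G \<omega>" "fits IV IO D C'"
      using occurring_interface_fits[OF I D o] by blast
    \<comment> \<open>The cluster at the heads of the arcs fits, and \<open>C\<close>, being met,
      must be that cluster.\<close>
    then show ?thesis using met_cluster_unique[OF C'(2,1) C] by blast
  qed
  have exists_cluster: "\<exists>C. C \<in> clusters G \<omega> \<and> meets G I C"
    if I: "interface G P v\<^sub>0 I" and o: "occurs \<omega> I" for I
  proof -
    obtain IV IO where eq: "I = (IV, IO)" by (cases I)
    obtain D where D: "interface_component G IV D" using interfaceD(4)[OF I[unfolded eq]] by blast
    obtain C where C: "C \<in> clusters G \<omega>" "fits IV IO D C"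
      using occurring_interface_fits[OF I[unfolded eq] D o[unfolded eq]] by blast
    show ?thesis unfolding eq using C(1) fits_meets[OF C(2) cluster_simple[OF C(1)]] by blast
  qed
  have unique_cluster: "C = C'"
    if I: "interface G P v\<^sub>0 I" and o: "occurs \<omega> I" and C: "C \<in> clusters G \<omega>" "meets G I C"
      and C': "C' \<in> clusters G \<omega>" "meets G I C'" for I C C'
  proof -
    obtain IV IO where eq: "I = (IV, IO)" by (cases I)
    obtain D where "fits IV IO D C'" using fit[OF I[unfolded eq] o[unfolded eq] C'[unfolded eq]] by blast
    then show ?thesis using C'(1) C[unfolded eq] by (rule met_cluster_unique)
  qed
  have first: "\<exists>!I. interface G P v\<^sub>0 I \<and> meets G I C \<and> occurs \<omega> I"
    if C: "C \<in> clusters G \<omega>" "finite (verts C)" "separates_from_infinity G (edge_boundary G C) v\<^sub>0" for C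
  proof -
    let ?O = "occupied_graph G \<omega>"
    obtain c where c: "c \<in> verts ?O" "C = component ?O c"
      using C(1) unfolding clusters_def graph_components_def by blast
    have conn_C: "connected_graph C"
      unfolding c(2) by (rule connected_component[OF simple_graph_occupied[OF simple] c(1)])
    have "verts C \<subseteq> verts G"
      using joined_verts(2)[of ?O c] c(2) by (auto simp: occupied_graph_def)
    then have sub: "subgraph C G" by (auto simp: subgraph_def c(2) occupied_graph_def)
    have "verts C \<noteq> {}" using conn_C by (simp add: connected_graph_def)
    then obtain X where X: "X \<in> graph_components (del_verts G (verts C))" "infinite (verts X)"
        "finite (verts G - verts X)"
      using cofinite_component[OF simple infinite_verts conn deg one_ended C(2)] sub
      unfolding subgraph_def by blast
    interpret finite_subgraph G P v\<^sub>0 C X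
      by standard (fact cluster_simple[OF C(1)] conn_C C(2) sub X)+
    obtain IV IO D where F: "fits IV IO D C" using fits_exists[OF C(3)] by blast
    \<comment> \<open>An occupied edge with an end in the cluster belongs to the cluster, so
      boundary edges are vacant.\<close>
    have "\<omega> e = 0" if "e \<in> IV" for e
    proof -
      have e: "e \<in> bd" using F that by (auto simp: fits_def)
      obtain u where "u \<in> e" "u \<in> verts C" using bd_touches[OF e] by blast
      moreover have eG: "e \<in> edges G" using e by (simp add: edge_boundary_def)
      ultimately obtain v where v: "e = {u, v}" using edge_otherE[OF simple] by metis
      have "e \<notin> edges ?O"
        using component_edge[OF simple_graph_occupied[OF simple], of u v \<omega> c] e \<open>u \<in> verts C\<close> c(2) v
        by (auto simp: edge_boundary_def)
      then show ?thesis using eG assms(10) by (auto simp: occupied_graph_def Pi_iff)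
    qed
    moreover have "\<omega> e = 1" if "e \<in> IO" for e
      using F that cluster_edges[OF C(1)] by (auto simp: fits_def)
    ultimately have occ: "occurs \<omega> (IV, IO)" by simp
    show ?thesis
    proof (rule ex1I[of _ "(IV, IO)"])
      show "interface G P v\<^sub>0 (IV, IO) \<and> meets G (IV, IO) C \<and> occurs \<omega> (IV, IO)"
        using F fits_meets[OF F simple_C] occ by (simp only: fits_def simp_thms)
    next
      fix I assume I: "interface G P v\<^sub>0 I \<and> meets G I C \<and> occurs \<omega> I"
      obtain IV' IO' where eq: "I = (IV', IO')" by (cases I)
      obtain D' where "fits IV' IO' D' C"
        using fit[of IV' IO' C] I[unfolded eq] C(1) by blast
      then have "IV = IV' \<and> IO = IO'" by (rule fits_unique[OF F])
      then show "I = (IV, IO)" using eq by simp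
    qed
  qed
  have incl: "IO \<subseteq> edges C \<and> IV \<subseteq> edge_boundary G C"
    if "interface G P v\<^sub>0 (IV, IO)" "meets G (IV, IO) C" "occurs \<omega> (IV, IO)" "C \<in> clusters G \<omega>"
    for IV IO C
    using fit[OF that(1,3,4,2)] unfolding fits_def by (elim exE conjE) (rule conjI)
  have sep: "separates_from_infinity G (edge_boundary G C) v\<^sub>0 \<and> finite (verts C)"
    if I: "interface G P v\<^sub>0 I" "occurs \<omega> I" and C: "C \<in> clusters G \<omega>" "meets G I C" for I C
  proof -
    obtain IV IO where eq: "I = (IV, IO)" by (cases I)
    obtain D where F: "fits IV IO D C" using fit[OF I[unfolded eq] C[unfolded eq]] by blast
    show ?thesis using fits_separates[OF F] fits_finite[OF F] by (rule conjI)
  qed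
  show ?thesis
  proof (intro conjI ballI allI impI)
    fix C assume C: "C \<in> clusters G \<omega>"
      and fs: "finite (verts C) \<and> separates_from_infinity G (edge_boundary G C) v\<^sub>0"
    show "\<exists>!I. interface G P v\<^sub>0 I \<and> meets G I C \<and> occurs \<omega> I"
      by (rule first[OF C conjunct1[OF fs] conjunct2[OF fs]])
    fix IV IO assume I: "interface G P v\<^sub>0 (IV, IO) \<and> meets G (IV, IO) C \<and> occurs \<omega> (IV, IO)"
    have "IO \<subseteq> edges C \<and> IV \<subseteq> edge_boundary G C"
      by (rule incl[OF conjunct1[OF I] conjunct1[OF conjunct2[OF I]] conjunct2[OF conjunct2[OF I]] C])
    then show "IO \<subseteq> edges C" "IV \<subseteq> edge_boundary G C" by (rule conjunct1, rule conjunct2)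
  next
    fix I assume "interface G P v\<^sub>0 I \<and> occurs \<omega> I"
    then have I: "interface G P v\<^sub>0 I" "occurs \<omega> I" by (rule conjunct1, rule conjunct2)
    show "\<exists>!C. C \<in> clusters G \<omega> \<and> meets G I C"
      by (rule ex_ex1I[OF exists_cluster[OF I]]) (elim conjE, rule unique_cluster[OF I])
    fix C assume C: "C \<in> clusters G \<omega> \<and> meets G I C"
    show "separates_from_infinity G (edge_boundary G C) v\<^sub>0" "finite (verts C)"
      using sep[OF I conjunct1[OF C] conjunct2[OF C]] by (rule conjunct1, rule conjunct2)
  qed
qed

end
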